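(* Let $U\subseteq\mathbb C^p$ be a connected open subset and $f:U\to Z$ a holomorphic map with $f^{-1}(Z_0)\ne\emptyset$. Fix $x_0\in f^{-1}(Z_0)$ and $v_0\in\pi^{-1}(f(x_0))$. Then there is a holomorphic map $F:U\to V$ with $\pi\circ F=f$ if and only if $f_*\big(\pi_1(f^{-1}(Z_0),x_0)\big)\subseteq\pi_*\big(\pi_1(V_0,v_0)\big)$ in $\pi_1(Z_0,f(x_0))$.
   Context: $V$ is a finite-dimensional complex vector space, $G\subset GL(V)$ a finite group, $Z=V/G$ realized as $\sigma(V)\subseteq\mathbb C^m$ via a minimal system of homogeneous generators $\sigma$ of $\mathbb C[V]^G$, with quotient map $\pi=\sigma$. $V_0$ is the set of points with trivial isotropy group and $Z_0=\pi(V_0)$; $\pi:V_0\to Z_0$ is a finite étale map. Holomorphic maps into $Z$ are holomorphic maps into $\mathbb C^m$ with values in $Z$. $f^{-1}(Z_0)$ is the complement in $U$ of a proper analytic subset, hence connected. *)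

theory Defs
  imports "HOL-Analysis.Analysis"
begin

inductive poly_fun :: "(complex^'n \<Rightarrow> complex) \<Rightarrow> bool" where
  const: "poly_fun (\<lambda>x. c)"
| coord: "poly_fun (\<lambda>x. x $ i)"
| add: "poly_fun p \<Longrightarrow> poly_fun q \<Longrightarrow> poly_fun (\<lambda>x. p x + q x)"
| mult: "poly_fun p \<Longrightarrow> poly_fun q \<Longrightarrow> poly_fun (\<lambda>x. p x * q x)"

inductive_set alg_gen :: "(complex^'n \<Rightarrow> complex) set \<Rightarrow> (complex^'n \<Rightarrow> complex) set"
  for S where
  const: "(\<lambda>x. c) \<in> alg_gen S"
| gen: "s \<in> S \<Longrightarrow> s \<in> alg_gen S"
| add: "p \<in> alg_gen S \<Longrightarrow> q \<in> alg_gen S \<Longrightarrow> (\<lambda>x. p x + q x) \<in> alg_gen S"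
| mult: "p \<in> alg_gen S \<Longrightarrow> q \<in> alg_gen S \<Longrightarrow> (\<lambda>x. p x * q x) \<in> alg_gen S"

definition finite_linear_group :: "(complex^'n^'n) set \<Rightarrow> bool" where
  "finite_linear_group G \<longleftrightarrow> finite G \<and> mat 1 \<in> G \<and> (\<forall>A\<in>G. invertible A \<and> matrix_inv A \<in> G)
     \<and> (\<forall>A\<in>G. \<forall>B\<in>G. A ** B \<in> G)"

definition invariant_ring :: "(complex^'n^'n) set \<Rightarrow> (complex^'n \<Rightarrow> complex) set" where
  "invariant_ring G = {q. poly_fun q \<and> (\<forall>A\<in>G. \<forall>x. q (A *v x) = q x)}"

definition homogeneous_fun :: "(complex^'n \<Rightarrow> complex) \<Rightarrow> bool" where
  "homogeneous_fun q \<longleftrightarrow> (\<exists>d::nat. \<forall>c x. q (c *s x) = c ^ d * q x)"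

definition comp_fun :: "(complex^'n \<Rightarrow> complex^'m) \<Rightarrow> 'm \<Rightarrow> (complex^'n \<Rightarrow> complex)" where
  "comp_fun \<sigma> i = (\<lambda>x. \<sigma> x $ i)"

definition minimal_homogeneous_generators ::
  "(complex^'n^'n) set \<Rightarrow> (complex^'n \<Rightarrow> complex^'m) \<Rightarrow> bool" where
  "minimal_homogeneous_generators G \<sigma> \<longleftrightarrow>
     (\<forall>i. comp_fun \<sigma> i \<in> invariant_ring G \<and> homogeneous_fun (comp_fun \<sigma> i))
   \<and> alg_gen (range (comp_fun \<sigma>)) = invariant_ring G
   \<and> (\<forall>i. comp_fun \<sigma> i \<notin> alg_gen (comp_fun \<sigma> ` (UNIV - {i})))"

definition free_locus :: "(complex^'n^'n) set \<Rightarrow> (complex^'n) set" where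
  "free_locus G = {v. \<forall>A\<in>G. A *v v = v \<longrightarrow> A = mat 1}"

definition holo_on :: "(complex^'p) set \<Rightarrow> (complex^'p \<Rightarrow> complex^'q) \<Rightarrow> bool" where
  "holo_on U f \<longleftrightarrow> (\<forall>x\<in>U. \<exists>L. (f has_derivative L) (at x) \<and> (\<forall>c v. L (c *s v) = c *s L v))"

text \<open>Inclusion f_*(pi_1(A,a)) \<subseteq> g_*(pi_1(B,b)) inside pi_1(C, f a), written on loops.\<close>
definition pi1_image_subset ::
  "('a::topological_space \<Rightarrow> 'c::topological_space) \<Rightarrow> 'a set \<Rightarrow> 'a
   \<Rightarrow> ('b::topological_space \<Rightarrow> 'c) \<Rightarrow> 'b set \<Rightarrow> 'b \<Rightarrow> 'c set \<Rightarrow> bool" where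
  "pi1_image_subset f A a g B b C \<longleftrightarrow>
     (\<forall>\<gamma>. path \<gamma> \<and> path_image \<gamma> \<subseteq> A \<and> pathstart \<gamma> = a \<and> pathfinish \<gamma> = a \<longrightarrow>
        (\<exists>\<delta>. path \<delta> \<and> path_image \<delta> \<subseteq> B \<and> pathstart \<delta> = b \<and> pathfinish \<delta> = b \<and>
             homotopic_paths C (f \<circ> \<gamma>) (g \<circ> \<delta>)))"

end

theory Submission
  imports Defs "HOL-Complex_Analysis.Conformal_Mappings"
begin

text \<open>Invariant polynomials separate the orbits of \<open>G\<close>, and by homogeneity \<open>\<sigma>\<close> is proper, hence open
  onto its image; so \<open>\<sigma>\<close> restricted to the free locus is a covering of its image. Choose an
  invariant polynomial \<open>P \<circ> \<sigma>\<close> that is nonzero at \<open>v0\<close> and vanishes off the free locus. The set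
  \<open>W\<close> where \<open>P \<circ> f\<close> is nonzero is open, dense and connected in \<open>U\<close>, and so is its trace on every
  ball, because the zeros of a holomorphic function on a complex line are isolated. The condition on
  fundamental groups lifts \<open>f\<close> continuously over \<open>W\<close>. The lift is holomorphic there because
  invariants give local coordinates at free points. It extends continuously to \<open>U\<close> since the
  cluster set at a point of \<open>U\<close> is connected and contained in a finite fibre. The extension is
  holomorphic along complex lines, hence holomorphic by Osgood's lemma. Conversely, after
  translating a lift \<open>F\<close> by an element of \<open>G\<close> so that it maps \<open>x0\<close> to \<open>v0\<close>, it carries loops to loops.\<close>

section \<open>Holomorphic functions of several variables\<close>

text \<open>Scalar form of \<open>holo_on\<close> at a single point: a real derivative that commutes
  with complex scalars. Being pointwise, it can be carried along lines and through
  polynomials.\<close>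

definition cdiff_at :: "(complex^'p \<Rightarrow> complex) \<Rightarrow> complex^'p \<Rightarrow> bool" where
  "cdiff_at h x \<longleftrightarrow> (\<exists>L. (h has_derivative L) (at x) \<and> (\<forall>c v. L (c *s v) = c * L v))"

lemma norm_smult: "norm (c *s (x::complex^'p)) = norm c * norm x"
  by (simp add: norm_vec_def norm_mult L2_set_right_distrib)

lemma bounded_linear_smult_left: "bounded_linear (\<lambda>t::complex. t *s (w::complex^'p))"
  by (rule bounded_linear_intro[where K="norm w"])
     (auto simp: vec_eq_iff algebra_simps norm_smult)

lemma has_derivative_vecI:
  fixes f :: "'a::real_normed_vector \<Rightarrow> complex^'q"
  assumes "\<And>i. ((\<lambda>x. f x $ i) has_derivative (\<lambda>w. L w $ i)) (at x)"
  shows "(f has_derivative L) (at x)"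
proof -
  have bl: "bounded_linear (axis i :: complex \<Rightarrow> complex^'q)" for i
    by (simp add: linear_conv_bounded_linear[symmetric], rule linearI) (auto simp: vec_eq_iff axis_def)
  have eq: "y = (\<Sum>i\<in>UNIV. axis i (y $ i))" for y :: "complex^'q"
    by (auto simp: vec_eq_iff axis_def sum.delta if_distrib cong: if_cong)
  have "((\<lambda>x. \<Sum>i\<in>UNIV. axis i (f x $ i)) has_derivative (\<lambda>w. \<Sum>i\<in>UNIV. axis i (L w $ i))) (at x)"
    by (intro has_derivative_sum bounded_linear.has_derivative[OF bl] assms)
  then show ?thesis
    by (simp flip: eq)
qed

lemma holo_on_iff_components:
  "holo_on U f \<longleftrightarrow> (\<forall>x\<in>U. \<forall>i. cdiff_at (\<lambda>x. f x $ i) x)"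
proof (intro iffI ballI allI)
  fix x i assume "holo_on U f" "x \<in> U"
  then obtain L where L: "(f has_derivative L) (at x)" "\<And>c v. L (c *s v) = c *s L v"
    by (auto simp: holo_on_def)
  have "((\<lambda>x. f x $ i) has_derivative (\<lambda>w. L w $ i)) (at x)"
    by (rule bounded_linear.has_derivative[OF bounded_linear_vec_nth L(1)])
  then show "cdiff_at (\<lambda>x. f x $ i) x"
    unfolding cdiff_at_def by (rule exI[of _ "\<lambda>w. L w $ i", OF conjI]) (simp add: L(2))
next
  assume *: "\<forall>x\<in>U. \<forall>i. cdiff_at (\<lambda>x. f x $ i) x"
  show "holo_on U f"
    unfolding holo_on_def
  proof
    fix x assume "x \<in> U"
    with * obtain L where L: "\<And>i. ((\<lambda>x. f x $ i) has_derivative L i) (at x)"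
      "\<And>i c v. L i (c *s v) = c * L i v"
      unfolding cdiff_at_def by metis
    show "\<exists>L. (f has_derivative L) (at x) \<and> (\<forall>c v. L (c *s v) = c *s L v)"
      by (rule exI[of _ "\<lambda>w. \<chi> i. L i w"])
         (use L in \<open>auto intro!: has_derivative_vecI simp: vec_eq_iff\<close>)
  qed
qed

lemma holo_on_imp_continuous_on: "holo_on U f \<Longrightarrow> continuous_on U f"
  unfolding holo_on_def
  by (meson continuous_at_imp_continuous_on has_derivative_continuous)

lemma cdiff_at_imp_continuous: "cdiff_at h x \<Longrightarrow> continuous (at x) h"
  unfolding cdiff_at_def using has_derivative_continuous by blast

lemma cdiff_at_const: "cdiff_at (\<lambda>x. c) x"
  unfolding cdiff_at_def by (rule exI[of _ "\<lambda>_. 0"]) auto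

lemma cdiff_at_add: "cdiff_at f x \<Longrightarrow> cdiff_at g x \<Longrightarrow> cdiff_at (\<lambda>x. f x + g x) x"
proof -
  assume "cdiff_at f x" "cdiff_at g x"
  then obtain L M where "(f has_derivative L) (at x)" "\<And>c v. L (c *s v) = c * L v"
    "(g has_derivative M) (at x)" "\<And>c v. M (c *s v) = c * M v"
    by (auto simp: cdiff_at_def)
  then show ?thesis
    unfolding cdiff_at_def
    by (intro exI[of _ "\<lambda>h. L h + M h"]) (simp add: has_derivative_add distrib_left)
qed

lemma cdiff_at_mult:
  assumes "cdiff_at f x" "cdiff_at g x"
  shows "cdiff_at (\<lambda>x. f x * g x) x"
proof -
  obtain L M where "(f has_derivative L) (at x)" "\<And>c v. L (c *s v) = c * L v"
    "(g has_derivative M) (at x)" "\<And>c v. M (c *s v) = c * M v"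
    using assms by (auto simp: cdiff_at_def)
  then show ?thesis
    unfolding cdiff_at_def
    by (intro exI[of _ "\<lambda>h. f x * M h + L h * g x"]) (simp add: has_derivative_mult, simp add: algebra_simps)
qed

text \<open>Complex homogeneity turns \<open>L (t *s w)\<close> into \<open>L w * t\<close>, a
  derivative in one complex variable. This opens the way to one-variable theory.\<close>

lemma cdiff_at_line:
  assumes "cdiff_at h (a + t0 *s w)"
  shows "(\<lambda>t. h (a + t *s w)) field_differentiable at t0"
proof -
  obtain L where L: "(h has_derivative L) (at (a + t0 *s w))" "\<And>c v. L (c *s v) = c * L v"
    using assms by (auto simp: cdiff_at_def)
  have "((\<lambda>t. a + t *s w) has_derivative (\<lambda>t. t *s w)) (at t0)"
    using has_derivative_add[OF has_derivative_const bounded_linear_imp_has_derivative[OF bounded_linear_smult_left]]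
    by simp
  from has_derivative_compose[OF this L(1)]
  have "((\<lambda>t. h (a + t *s w)) has_derivative (\<lambda>t. L w * t)) (at t0)"
    by (simp add: L(2) mult.commute)
  then show ?thesis
    by (auto simp: field_differentiable_def has_field_derivative_def)
qed

section \<open>Restriction to complex lines and the complement of a zero set\<close>

lemma continuous_line: "continuous_on S (\<lambda>t. a + t *s (w::complex^'p))"
  by (intro continuous_intros linear_continuous_on bounded_linear_smult_left)

lemma open_line: "open U \<Longrightarrow> open {t. a + t *s (w::complex^'p) \<in> U}"
  using open_vimage[OF _ continuous_line] by (simp add: vimage_def)

lemma convex_line:
  assumes "convex U"
  shows "convex {t. a + t *s (w::complex^'p) \<in> U}"
proof (rule convexI)
  fix x y :: complex and u v :: real
  assume *: "x \<in> {t. a + t *s w \<in> U}" "y \<in> {t. a + t *s w \<in> U}" "0 \<le> u" "0 \<le> v" "u + v = 1"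
  have "a + (u *\<^sub>R x + v *\<^sub>R y) *s w = u *\<^sub>R (a + x *s w) + v *\<^sub>R (a + y *s w)"
  proof -
    have "u *\<^sub>R a + v *\<^sub>R a = a"
      using * by (metis scaleR_left_distrib scaleR_one)
    then have "a $ i = of_real u * a $ i + of_real v * a $ i" for i
      by (metis vector_add_component vector_scaleR_component scaleR_conv_of_real)
    then show ?thesis
      unfolding vec_eq_iff vector_add_component vector_scaleR_component
        vector_smult_component scaleR_conv_of_real[where 'a=complex] by (simp add: algebra_simps)
  qed
  also have "\<dots> \<in> U"
    using * assms by (auto simp: convex_def)
  finally show "u *\<^sub>R x + v *\<^sub>R y \<in> {t. a + t *s w \<in> U}" by simp
qed

lemma holomorphic_on_line:
  assumes "\<And>x. x \<in> U \<Longrightarrow> cdiff_at h x"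
  shows "(\<lambda>t. h (a + t *s w)) holomorphic_on {t. a + t *s w \<in> U}"
  unfolding holomorphic_on_def
  using cdiff_at_line assms field_differentiable_at_within by blast

text \<open>The complex line through two points of the complement meets \<open>B\<close> in a convex
  planar domain on which \<open>h\<close> has only countably many zeros. A planar domain stays
  connected when a countable set is removed, so the two points are joined inside that line.\<close>

lemma connected_nonzero_convex:
  fixes B :: "(complex^'p) set"
  assumes "convex B" "open B" and h: "\<And>x. x \<in> B \<Longrightarrow> cdiff_at h x"
  shows "connected {x \<in> B. h x \<noteq> 0}"
  unfolding connected_iff_connected_component
proof (intro ballI)
  fix b c assume b: "b \<in> {x \<in> B. h x \<noteq> 0}" and c: "c \<in> {x \<in> B. h x \<noteq> 0}"
  define l where "l t = b + t *s (c - b)" for t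
  define D where "D = {t. b + t *s (c - b) \<in> B}"
  define K where "K = {t \<in> D. h (l t) = 0}"
  have l01: "l 0 = b" "l 1 = c"
    by (auto simp: l_def)
  have D: "open D" "connected D"
    unfolding D_def using assms by (blast intro: open_line convex_line convex_connected)+
  have hol: "(\<lambda>t. h (l t)) holomorphic_on D"
    unfolding D_def l_def by (rule holomorphic_on_line[OF h])
  have D01: "0 \<in> D" "1 \<in> D"
    using b c by (auto simp: D_def)
  have "countable K"
  \<comment> \<open>A constant restriction has the nonzero value \<open>h b\<close>, so there are no
    zeros. Otherwise countability of the zeros applies, which asks for a domain that is a countable
    union of closed sets.\<close>
  proof (cases "(\<lambda>t. h (l t)) constant_on D")
    case True
    then have "K = {}"
      using b l01 D01 by (auto simp: K_def constant_on_def)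
    then show ?thesis by simp
  next
    case False
    obtain F :: "nat \<Rightarrow> complex set" where "\<And>n. compact (F n)" "(\<Union>n. F n) = D"
      using open_Union_compact_subsets[OF D(1)] by metis
    then have "fsigma D"
      using fsigma.intros[of F] compact_imp_closed by metis
    then show ?thesis
      unfolding K_def using holomorphic_countable_zeros[OF hol D _ False] by blast
  qed
  then have "connected (D - K)"
    using D by (intro connected_open_diff_countable) auto
  then have "connected (l ` (D - K))"
    unfolding l_def by (intro connected_continuous_image continuous_line)
  moreover have "b \<in> l ` (D - K)" "c \<in> l ` (D - K)"
    using l01 D01 b c by (auto simp: K_def intro: rev_image_eqI)
  moreover have "l ` (D - K) \<subseteq> {x \<in> B. h x \<noteq> 0}"
    by (auto simp: K_def D_def l_def)
  ultimately show "connected_component {x \<in> B. h x \<noteq> 0} b c"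
    unfolding connected_component_def by blast
qed

text \<open>On the complex line from \<open>b\<close> to \<open>c\<close> the function is not
  identically zero, so a zero at \<open>c\<close> is isolated there and \<open>c\<close> is
  approached along that line.\<close>

lemma nonzero_dense_convex:
  fixes B :: "(complex^'p) set"
  assumes "convex B" "open B" and h: "\<And>x. x \<in> B \<Longrightarrow> cdiff_at h x"
    and b: "b \<in> B" "h b \<noteq> 0" and c: "c \<in> B"
  shows "c \<in> closure {x \<in> B. h x \<noteq> 0}"
proof (cases "h c = 0")
  case False
  then show ?thesis
    using c by (intro closure_subset[THEN subsetD]) simp
next
  case True
  define l where "l t = b + t *s (c - b)" for t
  define D where "D = {t. b + t *s (c - b) \<in> B}"
  have l01: "l 0 = b" "l 1 = c"
    by (auto simp: l_def)
  have D: "open D" "connected D"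
    unfolding D_def using assms by (blast intro: open_line convex_line convex_connected)+
  have hol: "(\<lambda>t. h (l t)) holomorphic_on D"
    unfolding D_def l_def by (rule holomorphic_on_line[OF h])
  have D01: "0 \<in> D" "1 \<in> D"
    using b c by (auto simp: D_def)
  obtain r where r: "0 < r" "ball 1 r \<subseteq> D" "\<And>z. z \<in> ball 1 r - {1} \<Longrightarrow> h (l z) \<noteq> 0"
    using isolated_zeros[OF hol D D01(2) _ D01(1)] l01 True b by metis
  have "1 \<in> closure (ball 1 r - {1::complex})"
    using r(1) by (simp add: islimpt_in_closure[symmetric] islimpt_ball)
  then have "l 1 \<in> closure (l ` (ball 1 r - {1}))"
  proof -
    have "l ` closure (ball 1 r - {1}) \<subseteq> closure (l ` (ball 1 r - {1}))"
      unfolding l_def by (rule image_closure_subset[OF continuous_line closed_closure closure_subset])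
    then show ?thesis using \<open>1 \<in> closure (ball 1 r - {1})\<close> by blast
  qed
  moreover have "l ` (ball 1 r - {1}) \<subseteq> {x \<in> B. h x \<noteq> 0}"
    using r by (auto simp: D_def l_def)
  ultimately show ?thesis
    using l01(2) by (metis closure_mono subsetD)
qed

text \<open>Identity theorem by a clopen argument: a ball around a point of the closure contains a
  nonzero of \<open>h\<close>, and the convex case spreads density over the whole ball.\<close>

lemma nonzero_dense:
  fixes U :: "(complex^'p) set"
  assumes "open U" "connected U" and h: "\<And>x. x \<in> U \<Longrightarrow> cdiff_at h x"
    and x0: "x0 \<in> U" "h x0 \<noteq> 0"
  shows "U \<subseteq> closure {x \<in> U. h x \<noteq> 0}"
proof -
  define Y where "Y = U \<inter> closure {x \<in> U. h x \<noteq> 0}"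
  have "open Y"
  proof (subst open_contains_ball, intro ballI)
    fix a assume a: "a \<in> Y"
    obtain r where r: "r > 0" "ball a r \<subseteq> U"
      using a \<open>open U\<close> unfolding Y_def open_contains_ball by blast
    obtain b where b: "b \<in> ball a r" "h b \<noteq> 0"
      using a r(1) unfolding Y_def
      by (smt (verit) IntE closure_approachable dist_commute mem_Collect_eq mem_ball)
    have "c \<in> Y" if "c \<in> ball a r" for c
    proof -
      have "c \<in> closure {x \<in> ball a r. h x \<noteq> 0}"
        using h r(2) that b by (intro nonzero_dense_convex[where b=b]) auto
      also have "\<dots> \<subseteq> closure {x \<in> U. h x \<noteq> 0}"
        using r(2) by (intro closure_mono) auto
      finally show ?thesis using that r(2) by (auto simp: Y_def)
    qed
    then show "\<exists>e>0. ball a e \<subseteq> Y" using r by auto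
  qed
  then have "openin (top_of_set U) Y"
    by (simp add: Y_def open_subset)
  moreover have "closedin (top_of_set U) Y"
    by (simp add: Y_def closedin_closed_Int)
  moreover have "x0 \<in> Y"
    using x0 closure_subset[of "{x \<in> U. h x \<noteq> 0}"] by (auto simp: Y_def)
  ultimately have "Y = U"
    using \<open>connected U\<close> unfolding connected_clopen by blast
  then show ?thesis by (auto simp: Y_def)
qed

lemma open_nonzero:
  assumes "open U" and h: "\<And>x. x \<in> U \<Longrightarrow> cdiff_at h x"
  shows "open {x \<in> U. h x \<noteq> 0}"
proof -
  have "continuous_on U h"
    by (intro continuous_at_imp_continuous_on ballI cdiff_at_imp_continuous h)
  then have "open (U \<inter> h -` (- {0}))"
    using assms(1) by (intro continuous_open_preimage) auto
  moreover have "U \<inter> h -` (- {0}) = {x \<in> U. h x \<noteq> 0}" by auto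
  ultimately show ?thesis by simp
qed

text \<open>If the complement split, density and connectedness of \<open>U\<close> would make the
  closures of the two pieces meet inside \<open>U\<close>. A small ball around a common point has
  connected trace by the convex case, yet meets both pieces.\<close>

lemma connected_nonzero:
  fixes U :: "(complex^'p) set"
  assumes U: "open U" "connected U" and h: "\<And>x. x \<in> U \<Longrightarrow> cdiff_at h x"
  shows "connected {x \<in> U. h x \<noteq> 0}"
proof (rule ccontr)
  define W where "W = {x \<in> U. h x \<noteq> 0}"
  have "open W"
    unfolding W_def by (rule open_nonzero[OF U(1) h])
  assume "\<not> connected {x \<in> U. h x \<noteq> 0}"
  then obtain A B where AB: "open A" "open B" "A \<inter> B \<inter> W = {}" "W \<subseteq> A \<union> B"
    "A \<inter> W \<noteq> {}" "B \<inter> W \<noteq> {}"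
    unfolding connected_def W_def by blast
  obtain x0 where "x0 \<in> U" "h x0 \<noteq> 0"
    using AB(5) by (auto simp: W_def)
  then have "U \<subseteq> closure W"
    unfolding W_def using nonzero_dense[OF U h] by blast
  also have "\<dots> \<subseteq> closure (A \<inter> W) \<union> closure (B \<inter> W)"
    using AB(4) by (subst closure_Un[symmetric], intro closure_mono) auto
  finally have cover: "U \<subseteq> closure (A \<inter> W) \<union> closure (B \<inter> W)" .
  moreover have "closure (A \<inter> W) \<inter> U \<noteq> {}" "closure (B \<inter> W) \<inter> U \<noteq> {}"
    using AB(5,6) closure_subset[of "A \<inter> W"] closure_subset[of "B \<inter> W"]
    by (auto simp: W_def)
  ultimately have "closure (A \<inter> W) \<inter> closure (B \<inter> W) \<inter> U \<noteq> {}"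
    using \<open>connected U\<close> unfolding connected_closed by (meson closed_closure)
  then obtain a where a: "a \<in> U" "a \<in> closure (A \<inter> W)" "a \<in> closure (B \<inter> W)"
    by blast
  obtain r where r: "r > 0" "ball a r \<subseteq> U"
    using a(1) U(1) unfolding open_contains_ball by blast
  have con: "connected {x \<in> ball a r. h x \<noteq> 0}"
    using h r by (intro connected_nonzero_convex) auto
  have sub: "{x \<in> ball a r. h x \<noteq> 0} \<subseteq> W"
    using r by (auto simp: W_def)
  obtain b c where "b \<in> A \<inter> W" "b \<in> ball a r" "c \<in> B \<inter> W" "c \<in> ball a r"
    using a(2,3) r(1) by (metis closure_approachable dist_commute mem_ball)
  then show False
    using connectedD[OF con AB(1,2)] AB(3,4) sub by (auto simp: W_def)
qed

lemma path_connected_nonzero: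
  fixes U :: "(complex^'p) set"
  assumes U: "open U" "connected U" and h: "\<And>x. x \<in> U \<Longrightarrow> cdiff_at h x"
  shows "path_connected {x \<in> U. h x \<noteq> 0}"
  by (intro connected_open_path_connected open_nonzero connected_nonzero assms)

section \<open>Cauchy estimates, Osgood's lemma and continuous extension\<close>

lemma second_order_bound:
  fixes \<phi> :: "complex \<Rightarrow> complex"
  assumes hol: "\<phi> holomorphic_on ball 0 R" and R: "R > 0"
    and bd: "\<And>t. t \<in> ball 0 R \<Longrightarrow> norm (\<phi> t) \<le> M" and t: "norm t \<le> R / 4"
  shows "norm (\<phi> t - \<phi> 0 - t * deriv \<phi> 0) \<le> 32 * M / R\<^sup>2 * (norm t)\<^sup>2"
proof -
  have op: "open (ball 0 R :: complex set)" by simp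
  define d where "d i = (deriv ^^ i) \<phi>" for i
  have "norm (d 0 t - (\<Sum>i\<le>1. d i 0 * (t - 0) ^ i / fact i)) \<le> 32 * M / R\<^sup>2 * norm (t - 0) ^ Suc 1 / fact 1"
  proof (rule complex_Taylor[where S="cball 0 (R/4)"])
    fix i x assume x: "x \<in> cball (0::complex) (R/4)"
    then have xR: "x \<in> ball 0 R" using R by auto
    have "d i holomorphic_on ball 0 R"
      unfolding d_def using holomorphic_higher_deriv[OF hol op] .
    then have "(d i has_field_derivative deriv (d i) x) (at x)"
      using xR op holomorphic_derivI by blast
    then show "(d i has_field_derivative d (Suc i) x) (at x within cball 0 (R/4))"
      by (simp add: d_def has_field_derivative_at_within)
    have sub: "cball x (R/4) \<subseteq> ball 0 R"
    proof
      fix y assume "y \<in> cball x (R/4)"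
      then have "norm (y - x) \<le> R/4" by (simp add: dist_norm norm_minus_commute)
      moreover have "norm x \<le> R/4" using x by simp
      ultimately show "y \<in> ball 0 R"
        using R norm_triangle_sub[of y x] by (simp add: norm_minus_commute)
    qed
    \<comment> \<open>Discs of radius \<open>R/4\<close> about points of
      \<open>cball 0 (R/4)\<close> stay inside \<open>ball 0 R\<close>; Cauchy's inequality for the
      second derivative then yields the constant 32.\<close>
    have "norm ((deriv ^^ 2) \<phi> x) \<le> fact 2 * M / (R/4) ^ 2"
    proof (rule Cauchy_inequality)
      show "\<phi> holomorphic_on ball x (R/4)"
        using hol sub by (meson ball_subset_cball holomorphic_on_subset)
      show "continuous_on (cball x (R/4)) \<phi>"
        using hol sub by (meson holomorphic_on_imp_continuous_on holomorphic_on_subset)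
      show "0 < R/4" using R by simp
      fix y assume "norm (x - y) = R/4"
      then have "y \<in> cball x (R/4)" by (simp add: dist_norm)
      then show "norm (\<phi> y) \<le> M" using bd sub by blast
    qed
    also have "fact 2 * M / (R/4) ^ 2 = 32 * M / R\<^sup>2"
      using R by (simp add: power2_eq_square field_simps)
    finally show "norm (d (Suc 1) x) \<le> 32 * M / R\<^sup>2"
      by (simp add: d_def numeral_2_eq_2)
  qed (use t R in auto)
  then show ?thesis
    by (simp add: d_def algebra_simps power2_eq_square)
qed

text \<open>Osgood's lemma. The Cauchy estimates make the error of the first-order expansion along
  complex lines quadratic, uniformly in the base point; this gives continuity of the directional
  derivative in the base point, and from that its additivity in the direction.\<close>

lemma osgood:
  fixes g :: "complex^'p \<Rightarrow> complex"
  assumes U: "open U" and cont: "continuous_on U g"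
    and line: "\<And>x w. x \<in> U \<Longrightarrow> (\<lambda>t. g (x + t *s w)) field_differentiable at 0"
    and a: "a \<in> U"
  shows "cdiff_at g a"
proof -
  define D where "D x w = deriv (\<lambda>t. g (x + t *s w)) 0" for x w
  \<comment> \<open>The hypothesis speaks of the parameter 0 only; taking \<open>x + t *s w\<close>
    as the new base point covers every other parameter.\<close>
  have lineh: "(\<lambda>t. g (x + t *s w)) holomorphic_on {t. x + t *s w \<in> U}" for x w
    unfolding holomorphic_on_def
  proof
    fix t assume "t \<in> {t. x + t *s w \<in> U}"
    then have "(\<lambda>s. g ((x + t *s w) + s *s w)) field_differentiable at 0"
      using line by blast
    then have "(\<lambda>s. g (x + s *s w)) \<circ> (\<lambda>s. t + s) field_differentiable at 0"
      by (simp add: o_def vector_sadd_rdistrib add.assoc)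
    then have "(\<lambda>s. g (x + s *s w)) field_differentiable at t"
      unfolding field_differentiable_def has_field_derivative_def
      using DERIV_at_within_shift[of "\<lambda>s. g (x + s *s w)" _ t 0 UNIV]
      by (auto simp: o_def has_field_derivative_def)
    then show "(\<lambda>t. g (x + t *s w)) field_differentiable at t within {t. x + t *s w \<in> U}"
      by (rule field_differentiable_at_within)
  qed
  have der: "((\<lambda>t. g (x + t *s w)) has_field_derivative D x w) (at 0)" if "x \<in> U" for x w
    using line[OF that, of w] unfolding D_def by (simp add: field_differentiable_derivI)
  have homog: "D x (c *s w) = c * D x w" if "x \<in> U" for x c w
  proof -
    have "((\<lambda>t. c * t) has_field_derivative c) (at 0)"
      using DERIV_cmult[OF DERIV_ident, of c 0 UNIV] by simp
    then have "((\<lambda>t. g (x + (c * t) *s w)) has_field_derivative D x w * c) (at 0)"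
      using DERIV_chain2[of "\<lambda>t. g (x + t *s w)" "D x w" "\<lambda>t. c * t" 0 c UNIV] der[OF that, of w] by simp
    then have "((\<lambda>t. g (x + t *s (c *s w))) has_field_derivative c * D x w) (at 0)"
      by (simp add: mult.commute)
    then show ?thesis
      using der[OF that] DERIV_unique by blast
  qed
  \<comment> \<open>The radius is doubled so that discs of radius \<open>r\<close> about points of
    \<open>ball a r\<close> remain in a compact set, on which \<open>g\<close> is bounded by one
    constant.\<close>
  obtain r where r: "r > 0" "cball a (2 * r) \<subseteq> U"
  proof -
    obtain e where "e > 0" "cball a e \<subseteq> U" using U a open_contains_cball by blast
    then show ?thesis using that[of "e/2"] by simp
  qed
  have "compact (g ` cball a (2*r))"
    using cont r(2) by (meson compact_cball compact_continuous_image continuous_on_subset)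
  then obtain M where M: "\<And>x. x \<in> cball a (2*r) \<Longrightarrow> norm (g x) \<le> M"
    by (metis bounded_iff compact_imp_bounded imageI)
  define K where "K = 32 * M / r\<^sup>2"
  \<comment> \<open>The one-variable bound is applied along the unit vector \<open>u\<close> at
    parameter \<open>norm w\<close>; this makes the constant \<open>K\<close> independent of both
    \<open>x\<close> and the direction.\<close>
  have est: "norm (g (x + w) - g x - D x w) \<le> K * (norm w)\<^sup>2"
    if x: "x \<in> ball a r" and w: "norm w \<le> r / 4" for x w
  proof (cases "w = 0")
    case True
    have "x \<in> U" using x r by (auto simp: subset_iff)
    then show ?thesis using True homog[of x 0 0] by simp
  next
    case False
    have xU: "x \<in> U" using x r by (auto simp: subset_iff)
    define u where "u = complex_of_real (1 / norm w) *s w"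
    have u: "norm u = 1" "w = complex_of_real (norm w) *s u"
      using False by (auto simp: u_def norm_smult norm_divide)
    have inb: "x + t *s u \<in> cball a (2*r)" if "t \<in> ball 0 r" for t
    proof -
      have "dist a (x + t *s u) \<le> dist a x + norm (t *s u)"
        by (metis add.commute dist_norm dist_triangle2 add_diff_cancel_left' dist_commute)
      then show ?thesis using x u that by (simp add: norm_smult)
    qed
    have "norm (g (x + complex_of_real (norm w) *s u) - g (x + 0 *s u)
           - complex_of_real (norm w) * deriv (\<lambda>t. g (x + t *s u)) 0)
        \<le> 32 * M / r\<^sup>2 * (norm (complex_of_real (norm w)))\<^sup>2"
    proof (rule second_order_bound)
      show "(\<lambda>t. g (x + t *s u)) holomorphic_on ball 0 r"
        by (rule holomorphic_on_subset[OF lineh]) (use inb r in blast)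
      show "norm (g (x + t *s u)) \<le> M" if "t \<in> ball 0 r" for t
        using M inb that by blast
    qed (use r w in auto)
    moreover have "complex_of_real (norm w) * deriv (\<lambda>t. g (x + t *s u)) 0 = D x w"
      using homog[OF xU, of "complex_of_real (norm w)" u] u(2) by (simp add: D_def)
    ultimately show ?thesis
      using u(2) by (simp add: K_def)
  qed
  have aU: "x \<in> U" if "x \<in> ball a r" for x
    using that r by (auto simp: subset_iff)
  have quot: "norm ((g (x + s *s w) - g x) / s - D x w) \<le> K * norm s * (norm w)\<^sup>2"
    if x: "x \<in> ball a r" and s: "s \<noteq> 0" "norm s * norm w \<le> r / 4" for x s w
  proof -
    have "(g (x + s *s w) - g x) / s - D x w = (g (x + s *s w) - g x - D x (s *s w)) / s"
      using s aU[OF x] by (simp add: homog field_simps)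
    also have "norm \<dots> \<le> K * (norm (s *s w))\<^sup>2 / norm s"
      unfolding norm_divide by (intro divide_right_mono est x) (use s in \<open>auto simp: norm_smult\<close>)
    also have "\<dots> = K * norm s * (norm w)\<^sup>2"
      using s by (simp add: norm_smult power2_eq_square field_simps)
    finally show ?thesis .
  qed
  have small: "\<forall>\<^sub>F s::complex in at 0. s \<noteq> 0 \<and> norm s * norm w \<le> r / 4" for w :: "complex^'p"
  proof -
    have "((\<lambda>s::complex. norm s * norm w) \<longlongrightarrow> 0) (at 0)"
      by (auto intro!: tendsto_eq_intros)
    then have "\<forall>\<^sub>F s::complex in at 0. norm s * norm w < r / 4"
      by (rule order_tendstoD) (use r in auto)
    then show ?thesis
      using eventually_neq_at_within[of 0] by eventually_elim auto
  qed
  \<comment> \<open>By \<open>quot\<close> the continuous difference quotients converge uniformly on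
    \<open>ball a r\<close>, so their limit is continuous in the base point.\<close>
  have contD: "isCont (\<lambda>x. D x w) a" for w
  proof -
    have "uniform_limit (ball a r) (\<lambda>s x. (g (x + s *s w) - g x) / s) (\<lambda>x. D x w) (at 0)"
    proof (rule uniform_limitI)
      fix e :: real assume "e > 0"
      have "((\<lambda>s::complex. K * norm s * (norm w)\<^sup>2) \<longlongrightarrow> 0) (at 0)"
        by (auto intro!: tendsto_eq_intros)
      then have "\<forall>\<^sub>F s::complex in at 0. K * norm s * (norm w)\<^sup>2 < e"
        by (rule order_tendstoD) (use \<open>e > 0\<close> in auto)
      then show "\<forall>\<^sub>F s in at 0. \<forall>x\<in>ball a r. dist ((g (x + s *s w) - g x) / s) (D x w) < e"
        using small[of w] by eventually_elim (use quot in \<open>force simp: dist_norm\<close>)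
    qed
    moreover have "\<forall>\<^sub>F s in at 0. continuous_on (ball a r) (\<lambda>x. (g (x + s *s w) - g x) / s)"
      using small[of w]
    proof eventually_elim
      case (elim s)
      have "x + s *s w \<in> cball a (2 * r)" if "x \<in> ball a r" for x
      proof -
        have "dist a (x + s *s w) \<le> dist a x + norm (s *s w)"
          by (metis add.commute dist_norm dist_triangle2 add_diff_cancel_left' dist_commute)
        then show ?thesis using elim that r(1) by (simp add: norm_smult)
      qed
      then have "(\<lambda>x. x + s *s w) ` ball a r \<subseteq> U" using r by blast
      then have "continuous_on (ball a r) (\<lambda>x. g (x + s *s w))"
        by (intro continuous_on_compose2[OF cont]) (auto intro!: continuous_intros)
      moreover have "continuous_on (ball a r) g"
        using cont aU continuous_on_subset by blast
      ultimately show ?case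
        using elim by (intro continuous_intros) auto
    qed
    ultimately have "continuous_on (ball a r) (\<lambda>x. D x w)"
      by (intro uniform_limit_theorem) auto
    then show ?thesis
      using r(1) by (simp add: continuous_on_eq_continuous_at)
  qed
  \<comment> \<open>The increment in direction \<open>u + w\<close> splits into one along
    \<open>u\<close> from \<open>a\<close> and one along \<open>w\<close> from the moving point
    \<open>a + s *s u\<close>. Uniformity of \<open>quot\<close> replaces the latter quotient by
    \<open>D (a + s *s u) w\<close>, which tends to \<open>D a w\<close> by
    \<open>contD\<close>.\<close>
  have add: "D a (u + w) = D a u + D a w" for u w
  proof -
    let ?E = "\<lambda>x s w. (g (x + s *s w) - g x) / s"
    have lim: "((\<lambda>s. ?E a s v) \<longlongrightarrow> D a v) (at 0)" for v
      using der[OF a, of v] by (simp add: has_field_derivative_iff)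
    have mv: "((\<lambda>s. a + s *s u) \<longlongrightarrow> a) (at 0)"
      using continuous_line[of UNIV a u, unfolded continuous_on_def, rule_format, of 0] by simp
    have "((\<lambda>s. D (a + s *s u) w) \<longlongrightarrow> D a w) (at 0)"
      using isCont_tendsto_compose[OF contD mv] .
    moreover have "((\<lambda>s. ?E (a + s *s u) s w - D (a + s *s u) w) \<longlongrightarrow> 0) (at 0)"
    proof (rule Lim_null_comparison)
      have "\<forall>\<^sub>F s in at 0. a + s *s u \<in> ball a r"
        using mv r(1) by (intro topological_tendstoD[OF mv]) auto
      then show "\<forall>\<^sub>F s in at 0. norm (?E (a + s *s u) s w - D (a + s *s u) w) \<le> K * norm s * (norm w)\<^sup>2"
        using small[of w] by eventually_elim (use quot in blast)
      show "((\<lambda>s::complex. K * norm s * (norm w)\<^sup>2) \<longlongrightarrow> 0) (at 0)"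
        by (auto intro!: tendsto_eq_intros)
    qed
    ultimately have "((\<lambda>s. ?E (a + s *s u) s w) \<longlongrightarrow> D a w) (at 0)"
      using tendsto_add by fastforce
    from tendsto_add[OF this lim[of u]]
    have "((\<lambda>s. ?E a s (u + w)) \<longlongrightarrow> D a w + D a u) (at 0)"
      by (simp add: add_divide_distrib[symmetric] vector_add_ldistrib add.assoc)
    then show ?thesis
      using tendsto_unique[OF _ _ lim[of "u + w"]] by (simp add: add.commute)
  qed
  have lin: "linear (D a)"
  proof (rule linearI)
    show "D a (u + w) = D a u + D a w" for u w by (rule add)
    show "D a (c *\<^sub>R w) = c *\<^sub>R D a w" for c w
    proof -
      have "c *\<^sub>R w = complex_of_real c *s w"
        by (simp add: vec_eq_iff scaleR_conv_of_real[where 'a=complex])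
      then show ?thesis
        using homog[OF a, of "complex_of_real c" w] by (simp add: scaleR_conv_of_real)
    qed
  qed
  have "(\<lambda>h. norm (g (a + h) - g a - D a h) / norm h) \<midarrow>0\<rightarrow> 0"
  proof (rule Lim_null_comparison)
    have "((\<lambda>h::complex^'p. norm h) \<longlongrightarrow> 0) (at 0)"
      by (auto intro!: tendsto_eq_intros)
    then have "\<forall>\<^sub>F h::complex^'p in at 0. norm h < r / 4"
      by (rule order_tendstoD) (use r in auto)
    then show "\<forall>\<^sub>F h in at 0. norm (norm (g (a + h) - g a - D a h) / norm h) \<le> K * norm h"
      using eventually_neq_at_within[of 0]
    proof eventually_elim
      case (elim h)
      then have "norm (g (a + h) - g a - D a h) \<le> K * (norm h)\<^sup>2"
        using est[of a h] r by simp
      then show ?case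
        using elim by (simp add: divide_le_eq power2_eq_square mult.assoc)
    qed
    show "((\<lambda>h::complex^'p. K * norm h) \<longlongrightarrow> 0) (at 0)"
      by (auto intro!: tendsto_eq_intros)
  qed
  then have "(g has_derivative D a) (at a)"
    using lin by (simp add: has_derivative_at linear_conv_bounded_linear)
  then show ?thesis
    unfolding cdiff_at_def using homog[OF a] by blast
qed

text \<open>A complex line on which \<open>h\<close> vanishes identically is a limit of parallel lines on which
  it does not.\<close>

lemma continuous_extension_cdiff_at:
  fixes g h :: "complex^'p \<Rightarrow> complex"
  assumes U: "open U" and cont: "continuous_on U g"
    and h: "\<And>x. x \<in> U \<Longrightarrow> cdiff_at h x"
    and dense: "U \<subseteq> closure {x \<in> U. h x \<noteq> 0}"
    and g: "\<And>x. x \<in> U \<Longrightarrow> h x \<noteq> 0 \<Longrightarrow> cdiff_at g x"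
    and a: "a \<in> U"
  shows "cdiff_at g a"
proof (rule osgood[OF U cont _ a])
  fix a w :: "complex^'p" assume a: "a \<in> U"
  obtain e where e: "e > 0" "cball a e \<subseteq> U"
    using U a open_contains_cball by blast
  \<comment> \<open>This keeps \<open>t *s w\<close> within \<open>e / 2\<close>; the summand 1
    covers \<open>w = 0\<close>.\<close>
  define R where "R = e / 2 / (norm w + 1)"
  have R: "R > 0" using e by (simp add: R_def add_nonneg_pos)
  have inU: "x + t *s w \<in> cball a e" if "dist x a \<le> e / 2" "norm t \<le> R" for x t
  proof -
    have "norm t * norm w \<le> R * (norm w + 1)"
      using that R by (intro mult_mono) auto
    also have "\<dots> = e / 2"
    proof -
      have "norm w + 1 \<noteq> 0" using norm_ge_zero[of w] by linarith
      then show ?thesis unfolding R_def by (metis nonzero_eq_divide_eq)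
    qed
    finally have "norm (t *s w) \<le> e / 2" by (simp add: norm_smult)
    moreover have "dist a (x + t *s w) \<le> dist a x + norm (t *s w)"
      by (metis add.commute dist_norm dist_triangle2 add_diff_cancel_left' dist_commute)
    ultimately show ?thesis using that by (simp add: dist_commute)
  qed
  have "a \<in> closure {x \<in> U. h x \<noteq> 0}"
    using dense a by blast
  then obtain X0 where X0: "\<And>n. X0 n \<in> {x \<in> U. h x \<noteq> 0}" "X0 \<longlonglongrightarrow> a"
    unfolding closure_sequential by blast
  have "\<forall>\<^sub>F n in sequentially. dist (X0 n) a < e / 2"
    using X0(2) e(1) by (intro tendstoD) auto
  then obtain N where N: "\<And>n. n \<ge> N \<Longrightarrow> dist (X0 n) a < e / 2"
    unfolding eventually_sequentially by blast
  \<comment> \<open>Dropping the first \<open>N\<close> terms puts all base points within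
    \<open>e / 2\<close> of \<open>a\<close>, so one disc of radius \<open>R\<close> serves every
    line.\<close>
  define X where "X n = X0 (n + N)" for n
  have X: "h (X n) \<noteq> 0" "dist (X n) a \<le> e / 2" for n
    using X0(1)[of "n + N"] N[of "n + N"] by (auto simp: X_def)
  have Xlim: "X \<longlonglongrightarrow> a"
    unfolding X_def using X0(2) by (rule LIMSEQ_ignore_initial_segment)
  have contl: "continuous_on (cball 0 R) (\<lambda>t. g (X n + t *s w))" for n
    by (rule continuous_on_compose2[OF cont continuous_line]) (use inU X e in auto)
  have hol: "(\<lambda>t. g (X n + t *s w)) holomorphic_on ball 0 R" for n
  proof -
    let ?\<psi> = "\<lambda>t. h (X n + t *s w)"
    have ball_sub: "cball 0 R \<subseteq> {t. X n + t *s w \<in> U}"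
      using inU X e by auto
    have hh: "?\<psi> holomorphic_on {t. X n + t *s w \<in> U}"
      by (rule holomorphic_on_line[OF h])
    have "?\<psi> holomorphic_on ball 0 R"
      using hh ball_sub ball_subset_cball holomorphic_on_subset by (metis subset_trans)
    have diff: "(\<lambda>t. g (X n + t *s w)) field_differentiable at t"
      if "t \<in> cball 0 R" "?\<psi> t \<noteq> 0" for t
      by (rule cdiff_at_line[OF g]) (use that ball_sub in blast)+
    \<comment> \<open>Since \<open>h (X n)\<close> is nonzero, zeros of \<open>h\<close> on this
      line are isolated, and the continuity of \<open>g\<close> makes them removable
      singularities.\<close>
    have "(\<lambda>t. g (X n + t *s w)) field_differentiable at t" if t: "t \<in> ball 0 R" for t
    proof (cases "?\<psi> t = 0")
      case False
      then show ?thesis using diff t by simp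
    next
      case True
      obtain \<rho> where \<rho>: "0 < \<rho>" "ball t \<rho> \<subseteq> ball 0 R" "\<And>z. z \<in> ball t \<rho> - {t} \<Longrightarrow> ?\<psi> z \<noteq> 0"
        using isolated_zeros[OF \<open>?\<psi> holomorphic_on ball 0 R\<close> _ _ t True, of 0] X(1) R
        by (metis add.right_neutral centre_in_ball connected_ball open_ball vector_smult_lzero)
      have "(\<lambda>t. g (X n + t *s w)) holomorphic_on ball t \<rho>"
      proof (rule no_isolated_singularity)
        show "continuous_on (ball t \<rho>) (\<lambda>t. g (X n + t *s w))"
          by (rule continuous_on_subset[OF contl]) (use \<rho>(2) in auto)
        show "(\<lambda>t. g (X n + t *s w)) holomorphic_on ball t \<rho> - {t}"
          unfolding holomorphic_on_def
          using diff \<rho>(2,3) field_differentiable_at_within by (metis DiffD1 ball_subset_cball subset_iff)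
      qed auto
      then show ?thesis
        using \<rho>(1) by (simp add: holomorphic_on_imp_differentiable_at)
    qed
    then show ?thesis
      unfolding holomorphic_on_def using field_differentiable_at_within by blast
  qed
  \<comment> \<open>Uniform continuity of \<open>g\<close> on the compact ball gives uniform
    convergence of the parallel restrictions, so holomorphy passes to the line through
    \<open>a\<close>.\<close>
  have "uniform_limit (cball 0 R) (\<lambda>n t. g (X n + t *s w)) (\<lambda>t. g (a + t *s w)) sequentially"
  proof (rule uniform_limitI)
    fix d :: real assume "d > 0"
    have "uniformly_continuous_on (cball a e) g"
      using cont e(2) by (meson compact_cball compact_uniformly_continuous continuous_on_subset)
    then obtain \<delta> where \<delta>: "\<delta> > 0"
      "\<And>x y. x \<in> cball a e \<Longrightarrow> y \<in> cball a e \<Longrightarrow> dist y x < \<delta> \<Longrightarrow> dist (g y) (g x) < d"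
      using \<open>d > 0\<close> unfolding uniformly_continuous_on_def by metis
    have "\<forall>\<^sub>F n in sequentially. dist (X n) a < \<delta>"
      using Xlim \<delta>(1) by (rule tendstoD)
    then show "\<forall>\<^sub>F n in sequentially. \<forall>t\<in>cball 0 R. dist (g (X n + t *s w)) (g (a + t *s w)) < d"
    proof eventually_elim
      case (elim n)
      show ?case
      proof
        fix t assume "t \<in> cball (0::complex) R"
        then show "dist (g (X n + t *s w)) (g (a + t *s w)) < d"
          using elim e(1) by (intro \<delta>(2) inU X(2)) auto
      qed
    qed
  qed
  then have "(\<lambda>t. g (a + t *s w)) holomorphic_on ball 0 R"
    using holomorphic_uniform_limit[of 0 R "\<lambda>n t. g (X n + t *s w)" sequentially] contl hol
    by (metis (no_types, lifting) eventually_sequentiallyI trivial_limit_sequentially)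
  then show "(\<lambda>t. g (a + t *s w)) field_differentiable at 0"
    using R by (simp add: holomorphic_on_imp_differentiable_at)
qed

section \<open>Invariant polynomials\<close>

lemma poly_fun_cdiff_at: "poly_fun p \<Longrightarrow> cdiff_at p x"
proof (induction rule: poly_fun.induct)
  case (coord i)
  show ?case
    unfolding cdiff_at_def
    by (intro exI[of _ "\<lambda>v. v $ i"] conjI bounded_linear_imp_has_derivative bounded_linear_vec_nth) simp
qed (auto intro: cdiff_at_const cdiff_at_add cdiff_at_mult)

lemma poly_fun_compose_cdiff_at:
  assumes "poly_fun P" and "\<And>i. cdiff_at (\<lambda>x. f x $ i) x"
  shows "cdiff_at (\<lambda>x. P (f x)) x"
  using assms(1)
  by induction (auto intro: cdiff_at_const cdiff_at_add cdiff_at_mult assms(2))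

lemma poly_fun_continuous_on: "poly_fun p \<Longrightarrow> continuous_on S p"
  by (intro continuous_at_imp_continuous_on ballI cdiff_at_imp_continuous poly_fun_cdiff_at)

lemma poly_fun_diff:
  assumes "poly_fun p" "poly_fun q"
  shows "poly_fun (\<lambda>x. p x - q x)"
  using poly_fun.add[OF assms(1) poly_fun.mult[OF poly_fun.const[of "-1"] assms(2)]] by simp

lemma poly_fun_sum: "(\<And>i. i \<in> I \<Longrightarrow> poly_fun (p i)) \<Longrightarrow> poly_fun (\<lambda>x. \<Sum>i\<in>I. p i x)"
  by (induction I rule: infinite_finite_induct) (auto intro: poly_fun.intros)

lemma poly_fun_prod: "(\<And>i. i \<in> I \<Longrightarrow> poly_fun (p i)) \<Longrightarrow> poly_fun (\<lambda>x. \<Prod>i\<in>I. p i x)"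
  by (induction I rule: infinite_finite_induct) (auto intro: poly_fun.intros)

lemma poly_fun_matrix:
  assumes "poly_fun p"
  shows "poly_fun (\<lambda>x. p (A *v x))"
  using assms
proof induction
  case (coord i)
  show ?case
    unfolding matrix_vector_mult_def
    by (simp add: poly_fun_sum poly_fun.intros)
qed (auto intro: poly_fun.intros)

text \<open>The pairing is bilinear, without conjugation, so that it is polynomial in the
  argument.\<close>

definition form :: "complex^'n \<Rightarrow> complex^'n \<Rightarrow> complex" where
  "form c x = (\<Sum>i\<in>UNIV. c $ i * x $ i)"

lemma form_diff: "form c (x - y) = form c x - form c y"
  by (simp add: form_def algebra_simps sum_subtractf)

lemma poly_fun_form: "poly_fun (form c)"
  unfolding form_def[abs_def] by (intro poly_fun_sum poly_fun.intros)

text \<open>Each nonzero vector excludes a hyperplane of coefficient vectors \<open>c\<close>, and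
  finitely many hyperplanes do not fill the space over an infinite field. The induction moves
  \<open>c\<close> along a coordinate in which the new vector is nonzero.\<close>

lemma exists_form_nonzero:
  fixes S :: "(complex^'n) set"
  assumes "finite S" "0 \<notin> S"
  shows "\<exists>c. \<forall>s\<in>S. form c s \<noteq> 0"
  using assms
proof (induction S)
  case empty
  then show ?case by simp
next
  case (insert s S)
  then obtain c where c: "\<And>x. x \<in> S \<Longrightarrow> form c x \<noteq> 0"
    by auto
  have "s \<noteq> 0"
    using insert.prems by auto
  then obtain i where i: "s $ i \<noteq> 0"
    by (auto simp: vec_eq_iff)
  \<comment> \<open>These are the values of \<open>e\<close> at which some form would vanish. Where
    \<open>x $ i = 0\<close> the quotient is 0 by convention, which merely excludes one more
    value.\<close>
  obtain e where e: "e \<notin> (\<lambda>x. - form c x / x $ i) ` insert s S"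
    using ex_new_if_finite[OF infinite_UNIV_char_0] insert.hyps(1) by (metis finite_imageI finite_insert)
  define c' where "c' = c + e *s axis i 1"
  have c': "form c' x = form c x + e * x $ i" for x
    by (simp add: form_def c'_def axis_def algebra_simps sum.distrib if_distrib[of "\<lambda>z. _ * z"]
        flip: sum_distrib_left cong: if_cong)
  have "form c' x \<noteq> 0" if x: "x \<in> insert s S" for x
  proof (cases "x $ i = 0")
    case True
    then show ?thesis using c c' i x by auto
  next
    case False
    have "e \<noteq> - form c x / x $ i" using e x by blast
    then show ?thesis
      using False by (auto simp: c' field_simps add_eq_0_iff)
  qed
  then show ?case by blast
qed

lemma matrix_inv_inverse:
  assumes "invertible A"
  shows "A ** matrix_inv A = mat 1" "matrix_inv A ** A = mat 1"
  using someI_ex[OF assms[unfolded invertible_def]] by (simp_all add: matrix_inv_def)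

section \<open>Invariants obtained from the group by sums and products\<close>

locale finite_quotient =
  fixes G :: "(complex^'n^'n) set" and \<sigma> :: "complex^'n \<Rightarrow> complex^'m"
  assumes group: "finite_linear_group G"
    and generators: "minimal_homogeneous_generators G \<sigma>"
begin

lemma finite_G: "finite G" and one_G: "mat 1 \<in> G"
  and mult_G: "A \<in> G \<Longrightarrow> B \<in> G \<Longrightarrow> A ** B \<in> G"
  and inv_G: "A \<in> G \<Longrightarrow> matrix_inv A \<in> G"
  and inv_left: "A \<in> G \<Longrightarrow> matrix_inv A ** A = mat 1"
  and inv_right: "A \<in> G \<Longrightarrow> A ** matrix_inv A = mat 1"
  using group by (auto simp: finite_linear_group_def matrix_inv_inverse)

lemma inv_apply: "A \<in> G \<Longrightarrow> matrix_inv A *v (A *v x) = x"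
  and apply_inv: "A \<in> G \<Longrightarrow> A *v (matrix_inv A *v x) = x"
  by (simp_all add: matrix_vector_mul_assoc inv_left inv_right)

lemma bij_mult_right:
  assumes "A \<in> G"
  shows "bij_betw (\<lambda>B. B ** A) G G"
  by (rule bij_betw_byWitness[where f'="\<lambda>B. B ** matrix_inv A"])
     (use assms in \<open>auto simp: mult_G inv_G inv_left inv_right simp flip: matrix_mul_assoc\<close>)

text \<open>Reynolds operator without normalization: replacing \<open>x\<close> by
  \<open>A *v x\<close> only permutes the summands.\<close>

lemma sum_invariant:
  assumes "poly_fun p"
  shows "(\<lambda>x. \<Sum>B\<in>G. p (B *v x)) \<in> invariant_ring G"
  unfolding invariant_ring_def
proof (intro CollectI conjI ballI allI)
  show "poly_fun (\<lambda>x. \<Sum>B\<in>G. p (B *v x))"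
    by (intro poly_fun_sum poly_fun_matrix assms)
  fix A x assume "A \<in> G"
  then show "(\<Sum>B\<in>G. p (B *v (A *v x))) = (\<Sum>B\<in>G. p (B *v x))"
    using sum.reindex_bij_betw[OF bij_mult_right, of A "\<lambda>B. p (B *v x)"]
    by (simp add: matrix_vector_mul_assoc)
qed

lemma prod_invariant:
  assumes "poly_fun p"
  shows "(\<lambda>x. \<Prod>B\<in>G. p (B *v x)) \<in> invariant_ring G"
  unfolding invariant_ring_def
proof (intro CollectI conjI ballI allI)
  show "poly_fun (\<lambda>x. \<Prod>B\<in>G. p (B *v x))"
    by (intro poly_fun_prod poly_fun_matrix assms)
  fix A x assume "A \<in> G"
  then show "(\<Prod>B\<in>G. p (B *v (A *v x))) = (\<Prod>B\<in>G. p (B *v x))"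
    using prod.reindex_bij_betw[OF bij_mult_right, of A "\<lambda>B. p (B *v x)"]
    by (simp add: matrix_vector_mul_assoc)
qed

text \<open>The generators of the algebra become coordinate functions on the target. This lets
  invariants be evaluated on \<open>f\<close> before any lift exists.\<close>

lemma invariant_factors:
  assumes "q \<in> invariant_ring G"
  obtains P where "poly_fun P" "\<And>x. q x = P (\<sigma> x)"
proof -
  have "q \<in> alg_gen (range (comp_fun \<sigma>))"
    using assms generators by (simp add: minimal_homogeneous_generators_def)
  then have "\<exists>P. poly_fun P \<and> (\<forall>x. q x = P (\<sigma> x))"
  proof induction
    case (const c)
    then show ?case by (auto intro!: exI[of _ "\<lambda>_. c"] poly_fun.const)
  next
    case (gen s)
    then obtain i where "s = comp_fun \<sigma> i" by blast
    then show ?case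
      by (auto intro!: exI[of _ "\<lambda>y. y $ i"] poly_fun.coord simp: comp_fun_def)
  next
    case (add p q)
    then obtain P Q where "poly_fun P" "\<forall>x. p x = P (\<sigma> x)" "poly_fun Q" "\<forall>x. q x = Q (\<sigma> x)"
      by blast
    then show ?case by (auto intro!: exI[of _ "\<lambda>y. P y + Q y"] poly_fun.add)
  next
    case (mult p q)
    then obtain P Q where "poly_fun P" "\<forall>x. p x = P (\<sigma> x)" "poly_fun Q" "\<forall>x. q x = Q (\<sigma> x)"
      by blast
    then show ?case by (auto intro!: exI[of _ "\<lambda>y. P y * Q y"] poly_fun.mult)
  qed
  then show ?thesis using that by blast
qed

section \<open>The quotient map: fibres, properness and openness\<close>

lemma component_invariant: "comp_fun \<sigma> i \<in> invariant_ring G"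
  using generators by (simp add: minimal_homogeneous_generators_def)

lemma sigma_invariant: "A \<in> G \<Longrightarrow> \<sigma> (A *v x) = \<sigma> x"
  using component_invariant by (simp add: vec_eq_iff invariant_ring_def comp_fun_def)

lemma continuous_on_sigma: "continuous_on S \<sigma>"
proof -
  have "continuous_on S (\<lambda>x. \<chi> i. comp_fun \<sigma> i x)"
    using component_invariant
    by (intro continuous_on_vec_lambda poly_fun_continuous_on) (auto simp: invariant_ring_def)
  then show ?thesis by (simp add: comp_fun_def)
qed

lemma tendsto_sigma: "(X \<longlongrightarrow> l) F \<Longrightarrow> ((\<lambda>n. \<sigma> (X n)) \<longlongrightarrow> \<sigma> l) F"
  using continuous_on_sigma[of UNIV] by (rule continuous_on_tendsto_compose) auto

lemma continuous_on_matrix: "continuous_on S (\<lambda>x::complex^'n. (A::complex^'n^'n) *v x)"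
  unfolding matrix_vector_mult_def
  by (intro continuous_on_vec_lambda continuous_intros)

text \<open>If \<open>w\<close> were off the orbit of \<open>v\<close>, some linear form would
  separate it from all points of that orbit. The product over the group of the form minus its value
  at \<open>w\<close> is invariant, vanishes at \<open>w\<close> through the identity factor, and is
  nonzero at \<open>v\<close>.\<close>

lemma sigma_separates_orbits:
  assumes "\<sigma> v = \<sigma> w"
  obtains A where "A \<in> G" "w = A *v v"
proof (rule ccontr)
  assume "\<not> thesis"
  then have "w \<noteq> A *v v" if "A \<in> G" for A
    using that \<open>\<And>A. A \<in> G \<Longrightarrow> w = A *v v \<Longrightarrow> thesis\<close> by blast
  then have "0 \<notin> (\<lambda>A. A *v v - w) ` G"
    by force
  then obtain c where c: "\<And>A. A \<in> G \<Longrightarrow> form c (A *v v - w) \<noteq> 0"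
    using exists_form_nonzero[of "(\<lambda>A. A *v v - w) ` G"] finite_G by auto
  let ?q = "\<lambda>x. \<Prod>B\<in>G. form c (B *v x) - form c w"
  have "?q \<in> invariant_ring G"
    by (rule prod_invariant[of "\<lambda>x. form c x - form c w"])
       (intro poly_fun_diff poly_fun_form poly_fun.const)
  then obtain P where "\<And>x. ?q x = P (\<sigma> x)"
    by (rule invariant_factors) blast
  then have "?q v = ?q w" using assms by metis
  moreover have "?q w = 0"
    using finite_G one_G by (intro prod_zero) (auto intro: bexI[of _ "mat 1"])
  moreover have "?q v \<noteq> 0"
    using c finite_G by (simp add: form_diff)
  ultimately show False by simp
qed

text \<open>Positivity of the degree comes from minimality: a generator of degree 0 is constant, and
  constants are already generated by the others.\<close>

lemma component_homogeneous:
  obtains d where "d > 0" "\<And>c x. \<sigma> (c *s x) $ i = c ^ d * \<sigma> x $ i"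
proof -
  obtain d where d: "\<And>c x. comp_fun \<sigma> i (c *s x) = c ^ d * comp_fun \<sigma> i x"
    using generators unfolding minimal_homogeneous_generators_def homogeneous_fun_def by blast
  have "d \<noteq> 0"
  proof
    assume "d = 0"
    \<comment> \<open>Scaling by 0 with the convention \<open>0 ^ 0 = 1\<close>.\<close>
    then have "comp_fun \<sigma> i x = comp_fun \<sigma> i 0" for x
      using d[of 0 x] by simp
    then have "comp_fun \<sigma> i = (\<lambda>x. comp_fun \<sigma> i 0)" by blast
    then have "comp_fun \<sigma> i \<in> alg_gen (comp_fun \<sigma> ` (UNIV - {i}))"
      by (metis alg_gen.const)
    then show False
      using generators unfolding minimal_homogeneous_generators_def by blast
  qed
  then show ?thesis
    using that d by (simp add: comp_fun_def)
qed

text \<open>Positive degrees give \<sigma> the value 0 at the origin, whose orbit is a single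
  point.\<close>

lemma sigma_eq_0D:
  assumes "\<sigma> v = 0"
  shows "v = 0"
proof -
  have "\<sigma> 0 = 0"
  proof (subst vec_eq_iff, intro allI)
    fix i
    obtain d where "d > 0" "\<And>c x. \<sigma> (c *s x) $ i = c ^ d * \<sigma> x $ i"
      using component_homogeneous[of i] by blast
    then show "\<sigma> 0 $ i = 0 $ i"
      by (metis mult_eq_0_iff power_eq_0_iff vector_smult_lzero zero_index)
  qed
  then obtain A where "A \<in> G" "v = A *v 0"
    using sigma_separates_orbits[of 0 v] assms by auto
  then show ?thesis by simp
qed

text \<open>Properness of \<open>\<sigma>\<close>: rescaling an unbounded sequence with bounded image to the unit sphere
  yields a nonzero vector in the null fibre.\<close>

lemma bounded_vimage_sigma:
  assumes "bounded S"
  shows "bounded (\<sigma> -` S)"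
proof (rule ccontr)
  assume "\<not> bounded (\<sigma> -` S)"
  \<comment> \<open>The summand 1 makes every norm exceed 1, so that a positive power of its
    reciprocal is at most the reciprocal itself.\<close>
  then have "\<exists>v. \<sigma> v \<in> S \<and> norm v > real n + 1" for n :: nat
    unfolding bounded_iff by (metis not_le vimageE)
  then obtain X where X: "\<And>n. \<sigma> (X n) \<in> S" "\<And>n. norm (X n) > real n + 1"
    by metis
  obtain M where M: "\<And>y. y \<in> S \<Longrightarrow> norm y \<le> M"
    using assms bounded_iff by blast
  define Y where "Y n = complex_of_real (1 / norm (X n)) *s X n" for n
  have Xpos: "norm (X n) > 0" for n
    using X(2)[of n] by linarith
  then have Y1: "norm (Y n) = 1" for n
    by (simp add: Y_def norm_smult norm_divide)
  then have "\<And>n. Y n \<in> sphere 0 1" by simp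
  then obtain l r where l: "l \<in> sphere 0 1" "strict_mono r" "(Y \<circ> r) \<longlonglongrightarrow> l"
    using compact_sphere[of 0 1] unfolding compact_def by metis
  have lim0: "(\<lambda>n. \<sigma> (Y n)) \<longlonglongrightarrow> 0"
  proof (rule vec_tendstoI)
    fix i
    obtain d where d: "d > 0" "\<And>c x. \<sigma> (c *s x) $ i = c ^ d * \<sigma> x $ i"
      using component_homogeneous[of i] by blast
    show "(\<lambda>n. \<sigma> (Y n) $ i) \<longlonglongrightarrow> 0 $ i"
    proof (simp, rule Lim_null_comparison)
      show "\<forall>\<^sub>F n in sequentially. norm (\<sigma> (Y n) $ i) \<le> inverse (real (Suc n)) * M"
      proof (intro always_eventually allI)
        fix n
        have "norm (\<sigma> (Y n) $ i) = (1 / norm (X n)) ^ d * norm (\<sigma> (X n) $ i)"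
          by (simp add: Y_def d norm_mult norm_power norm_divide)
        also have "\<dots> \<le> inverse (real (Suc n)) * M"
        proof (rule mult_mono)
          have "1 / norm (X n) \<le> inverse (real (Suc n))"
            using X(2)[of n] le_imp_inverse_le[of "real (Suc n)" "norm (X n)"]
            by (simp add: inverse_eq_divide)
          moreover have "1 / norm (X n) \<le> 1"
            using X(2)[of n] by (subst divide_le_eq_1_pos[OF Xpos]) linarith
          moreover have "(1 / norm (X n)) ^ d \<le> (1 / norm (X n)) ^ 1"
            using calculation(2) d(1) by (intro power_decreasing) auto
          ultimately show "(1 / norm (X n)) ^ d \<le> inverse (real (Suc n))" by simp
          show "norm (\<sigma> (X n) $ i) \<le> M"
            using M[OF X(1)] Finite_Cartesian_Product.norm_nth_le order_trans by blast
        qed auto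
        finally show "norm (\<sigma> (Y n) $ i) \<le> inverse (real (Suc n)) * M" .
      qed
      show "(\<lambda>n. inverse (real (Suc n)) * M) \<longlonglongrightarrow> 0"
        using tendsto_mult_left_zero[OF LIMSEQ_inverse_real_of_nat] by blast
    qed
  qed
  have "(\<lambda>n. \<sigma> (Y (r n))) \<longlonglongrightarrow> \<sigma> l"
    using tendsto_sigma[OF l(3)] by simp
  moreover have "(\<lambda>n. \<sigma> (Y (r n))) \<longlonglongrightarrow> 0"
    using LIMSEQ_subseq_LIMSEQ[OF lim0 l(2)] by (simp add: o_def)
  ultimately have "\<sigma> l = 0"
    using LIMSEQ_unique by blast
  then show False
    using sigma_eq_0D l(1) by fastforce
qed

text \<open>Sequential form of properness, used for openness and for cluster values of a
  lift.\<close>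

lemma sigma_convergent_subseq:
  assumes "(\<lambda>n. \<sigma> (X n)) \<longlonglongrightarrow> z"
  obtains l r where "strict_mono r" "(X \<circ> r) \<longlonglongrightarrow> l" "\<sigma> l = z"
proof -
  have "bounded (range (\<lambda>n. \<sigma> (X n)))"
    using assms by (rule convergent_imp_bounded)
  then have "bounded (range X)"
    by (rule bounded_subset[OF bounded_vimage_sigma]) auto
  then obtain l r where lr: "strict_mono r" "(X \<circ> r) \<longlonglongrightarrow> l"
    using bounded_imp_convergent_subsequence by blast
  have "(\<lambda>n. \<sigma> (X (r n))) \<longlonglongrightarrow> \<sigma> l"
    using tendsto_sigma[OF lr(2)] by simp
  moreover have "(\<lambda>n. \<sigma> (X (r n))) \<longlonglongrightarrow> z"
    using LIMSEQ_subseq_LIMSEQ[OF assms lr(1)] by (simp add: o_def)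
  ultimately have "\<sigma> l = z" using LIMSEQ_unique by blast
  then show ?thesis using that lr by blast
qed

text \<open>Otherwise points with images outside the image of \<open>N\<close> have images
  converging to \<open>\<sigma> v\<close>. By properness a subsequence converges into the fibre of
  \<open>v\<close>; a group element moves its limit to \<open>v\<close>, and then its terms enter
  \<open>N\<close>.\<close>

lemma sigma_open_map:
  assumes "open N"
  shows "openin (top_of_set (range \<sigma>)) (\<sigma> ` N)"
  unfolding openin_euclidean_subtopology_iff
proof (intro conjI ballI)
  fix z assume "z \<in> \<sigma> ` N"
  then obtain v where v: "v \<in> N" "z = \<sigma> v" by blast
  show "\<exists>e>0. \<forall>x'\<in>range \<sigma>. dist x' z < e \<longrightarrow> x' \<in> \<sigma> ` N"
  proof (rule ccontr)
    assume neg: "\<not> ?thesis"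
    have "\<exists>x. dist (\<sigma> x) z < inverse (real (Suc n)) \<and> \<sigma> x \<notin> \<sigma> ` N" for n
      using neg by (metis inverse_positive_iff_positive of_nat_0_less_iff rangeE zero_less_Suc)
    then obtain X where X: "\<And>n. dist (\<sigma> (X n)) z < inverse (real (Suc n))" "\<And>n. \<sigma> (X n) \<notin> \<sigma> ` N"
      by metis
    have "(\<lambda>n. \<sigma> (X n)) \<longlonglongrightarrow> z"
      by (rule metric_tendsto_imp_tendsto[OF LIMSEQ_inverse_real_of_nat])
         (use X(1) in \<open>auto intro!: always_eventually less_imp_le\<close>)
    then obtain l r where lr: "(X \<circ> r) \<longlonglongrightarrow> l" "\<sigma> l = z"
      using sigma_convergent_subseq by blast
    obtain A where A: "A \<in> G" "v = A *v l"
      using sigma_separates_orbits[of l v] lr(2) v(2) by metis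
    have "(\<lambda>n. A *v (X \<circ> r) n) \<longlonglongrightarrow> A *v l"
      using continuous_on_matrix[of UNIV A] lr(1) by (rule continuous_on_tendsto_compose) auto
    then have "\<forall>\<^sub>F n in sequentially. A *v (X \<circ> r) n \<in> N"
      using assms v(1) A(2) by (intro topological_tendstoD) auto
    then obtain n where "A *v X (r n) \<in> N"
      by (auto simp: eventually_sequentially)
    then have "\<sigma> (X (r n)) \<in> \<sigma> ` N"
      by (metis A(1) imageI sigma_invariant)
    then show False using X(2) by blast
  qed
qed auto

section \<open>The free locus, its covering map and a discriminant\<close>

lemma free_locus_invariant:
  assumes "v \<in> free_locus G" "A \<in> G"
  shows "A *v v \<in> free_locus G"
  unfolding free_locus_def
proof (intro CollectI ballI impI)
  fix B assume B: "B \<in> G" "B *v (A *v v) = A *v v"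
  \<comment> \<open>Isotropy groups along an orbit are conjugate.\<close>
  then have "(matrix_inv A ** B ** A) *v v = v"
    using assms inv_apply by (simp flip: matrix_vector_mul_assoc)
  moreover have "matrix_inv A ** B ** A \<in> G"
    using assms B by (simp add: mult_G inv_G)
  ultimately have "matrix_inv A ** B ** A = mat 1"
    using assms by (auto simp: free_locus_def)
  then have "A ** (matrix_inv A ** B ** A) ** matrix_inv A = A ** mat 1 ** matrix_inv A"
    by simp
  then show "B = mat 1"
    using assms(2) by (simp add: matrix_mul_assoc inv_right) (simp add: inv_right flip: matrix_mul_assoc)
qed

lemma sigma_in_free_iff: "\<sigma> v \<in> \<sigma> ` free_locus G \<longleftrightarrow> v \<in> free_locus G"
  by (metis free_locus_invariant imageE imageI sigma_separates_orbits)

text \<open>A small neighbourhood \<open>N\<close> of a free point has pairwise disjoint translates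
  under the group. They are the sheets over its image, and openness of \<sigma> makes the
  restriction to each a homeomorphism.\<close>

lemma covering_space_sigma: "covering_space (free_locus G) \<sigma> (\<sigma> ` free_locus G)"
proof (rule covering_spaceI)
  fix z assume "z \<in> \<sigma> ` free_locus G"
  then obtain v where v: "v \<in> free_locus G" "z = \<sigma> v" by blast
  \<comment> \<open>The least displacement of \<open>v\<close> by a nontrivial element; the inserted
    1 keeps the set nonempty when the group is trivial.\<close>
  define m where "m = Min (insert 1 ((\<lambda>A. dist (A *v v) v) ` (G - {mat 1})))"
  have mpos: "m > 0"
    using v(1) finite_G unfolding m_def free_locus_def by (subst Min_gr_iff) auto
  have mle: "m \<le> dist (A *v v) v" if "A \<in> G - {mat 1}" for A
    unfolding m_def using finite_G that by (intro Min_le) auto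
  \<comment> \<open>Points of \<open>N\<close> are less than \<open>m/2\<close> apart, whereas a
    nontrivial element moves each of them by more than \<open>m/2\<close>.\<close>
  define N where "N = ball v (m/4) \<inter> (\<Inter>A\<in>G - {mat 1}. {x. dist (A *v x) x > m/2})"
  have openN: "open N"
    unfolding N_def using finite_G
    by (intro open_Int open_INT open_ball open_Collect_less ballI continuous_intros continuous_on_matrix) auto
  have vN: "v \<in> N"
    using mpos mle by (force simp: N_def)
  have moved: "A = mat 1" if "A \<in> G" "x \<in> N" "A *v x \<in> N" for A x
  proof (rule ccontr)
    assume "A \<noteq> mat 1"
    then have "dist (A *v x) x > m/2" using that by (auto simp: N_def)
    moreover have "dist v x < m/4" "dist v (A *v x) < m/4"
      using that by (auto simp: N_def)
    ultimately show False
      using dist_triangle[of "A *v x" x v] by (simp add: dist_commute)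
  qed
  have Nfree: "N \<subseteq> free_locus G"
    using moved by (auto simp: free_locus_def)
  define T where "T = \<sigma> ` N"
  have sub: "\<sigma> ` (\<lambda>x. A *v x) ` N = T" if "A \<in> G" for A
    unfolding T_def image_image using sigma_invariant that by simp
  have openAN: "open ((\<lambda>x. A *v x) ` N)" if "A \<in> G" for A
  proof -
    have "(\<lambda>x. A *v x) ` N = (\<lambda>x. matrix_inv A *v x) -` N"
    proof (intro equalityI subsetI)
      fix x assume "x \<in> (\<lambda>x. matrix_inv A *v x) -` N"
      then show "x \<in> (\<lambda>x. A *v x) ` N"
        using apply_inv[OF that] by (metis imageI vimageE)
    qed (use that in \<open>auto simp: inv_apply\<close>)
    then show ?thesis
      using open_vimage[OF openN continuous_on_matrix] by simp
  qed
  have injN: "inj_on \<sigma> ((\<lambda>x. A *v x) ` N)" if "A \<in> G" for A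
  proof (rule inj_onI, clarify)
    fix x y assume xy: "x \<in> N" "y \<in> N" "\<sigma> (A *v x) = \<sigma> (A *v y)"
    then have "\<sigma> x = \<sigma> y" using that sigma_invariant by simp
    then obtain B where "B \<in> G" "y = B *v x" using sigma_separates_orbits by blast
    then show "A *v x = A *v y" using moved xy by fastforce
  qed
  show "\<exists>T. z \<in> T \<and> openin (top_of_set (\<sigma> ` free_locus G)) T \<and>
          (\<exists>\<V>. \<Union>\<V> = free_locus G \<inter> \<sigma> -` T \<and>
            (\<forall>u\<in>\<V>. openin (top_of_set (free_locus G)) u) \<and>
            pairwise disjnt \<V> \<and> (\<forall>u\<in>\<V>. \<exists>q. homeomorphism u T \<sigma> q))"
  proof (intro exI[of _ T] conjI exI[of _ "(\<lambda>A. (\<lambda>x. A *v x) ` N) ` G"] ballI)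
    show "z \<in> T" using v vN by (simp add: T_def)
    show "openin (top_of_set (\<sigma> ` free_locus G)) T"
      unfolding T_def
      by (rule openin_subset_trans[OF sigma_open_map[OF openN]]) (use Nfree in auto)
    show "\<Union>((\<lambda>A. (\<lambda>x. A *v x) ` N) ` G) = free_locus G \<inter> \<sigma> -` T"
    proof (intro equalityI subsetI)
      fix y assume "y \<in> \<Union>((\<lambda>A. (\<lambda>x. A *v x) ` N) ` G)"
      then show "y \<in> free_locus G \<inter> \<sigma> -` T"
        using Nfree free_locus_invariant sigma_invariant by (auto simp: T_def)
    next
      fix y assume "y \<in> free_locus G \<inter> \<sigma> -` T"
      then obtain x where "x \<in> N" "\<sigma> x = \<sigma> y" by (auto simp: T_def)
      then obtain A where "A \<in> G" "y = A *v x" using sigma_separates_orbits by blast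
      then show "y \<in> \<Union>((\<lambda>A. (\<lambda>x. A *v x) ` N) ` G)" using \<open>x \<in> N\<close> by blast
    qed
    show "pairwise disjnt ((\<lambda>A. (\<lambda>x. A *v x) ` N) ` G)"
    proof (rule pairwise_imageI)
      fix A B assume AB: "A \<in> G" "B \<in> G" "A \<noteq> B"
      show "disjnt ((\<lambda>x. A *v x) ` N) ((\<lambda>x. B *v x) ` N)"
      proof (rule ccontr)
        assume "\<not> ?thesis"
        then obtain x y where xy: "x \<in> N" "y \<in> N" "A *v x = B *v y"
          by (auto simp: disjnt_def)
        then have "(matrix_inv B ** A) *v x = y"
          using AB(2) by (simp add: inv_apply flip: matrix_vector_mul_assoc)
        then have "matrix_inv B ** A = mat 1"
          using moved xy AB by (simp add: mult_G inv_G)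
        then have "B ** (matrix_inv B ** A) = B" by simp
        then show False using AB by (simp add: matrix_mul_assoc inv_right)
      qed
    qed
    fix u assume "u \<in> (\<lambda>A. (\<lambda>x. A *v x) ` N) ` G"
    then obtain A where A: "A \<in> G" "u = (\<lambda>x. A *v x) ` N" by blast
    then have u: "open u" "u \<subseteq> free_locus G"
      using openAN Nfree free_locus_invariant by auto
    then show "openin (top_of_set (free_locus G)) u" by (simp add: open_subset)
    show "\<exists>q. homeomorphism u T \<sigma> q"
    proof (rule homeomorphism_injective_open_map[of u \<sigma> T])
      show "continuous_on u \<sigma>" by (rule continuous_on_sigma)
      show "\<sigma> ` u = T" "inj_on \<sigma> u" using sub injN A by auto
      fix O' assume "openin (top_of_set u) O'"
      then have "open O'" "O' \<subseteq> u" using u(1) openin_open_eq by auto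
      then show "openin (top_of_set T) (\<sigma> ` O')"
        using \<open>\<sigma> ` u = T\<close>
        by (intro openin_subset_trans[OF sigma_open_map]) (auto simp: T_def)
    qed blast
  qed
qed (auto intro: continuous_on_sigma)

text \<open>The inner product \<open>?p\<close> has a zero factor at any point fixed by a nontrivial
  element; the outer product makes it invariant. The form is chosen to be nonzero on all
  displacements along the orbit of \<open>v\<close>.\<close>

lemma exists_discriminant:
  assumes "v \<in> free_locus G"
  obtains P where "poly_fun P" "P (\<sigma> v) \<noteq> 0" "\<And>w. P (\<sigma> w) \<noteq> 0 \<Longrightarrow> w \<in> free_locus G"
proof -
  let ?S = "(\<lambda>(A, B). A *v (B *v v) - B *v v) ` ((G - {mat 1}) \<times> G)"
  have "0 \<notin> ?S"
    using free_locus_invariant[OF assms] by (auto simp: free_locus_def)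
  then obtain c where c: "\<And>A B. A \<in> G - {mat 1} \<Longrightarrow> B \<in> G \<Longrightarrow> form c (A *v (B *v v) - B *v v) \<noteq> 0"
    using exists_form_nonzero[of ?S] finite_G by fastforce
  let ?p = "\<lambda>x. \<Prod>A\<in>G - {mat 1}. form c (A *v x) - form c x"
  let ?q = "\<lambda>x. \<Prod>B\<in>G. ?p (B *v x)"
  have "?q \<in> invariant_ring G"
    by (rule prod_invariant[of ?p])
       (intro poly_fun_prod poly_fun_diff poly_fun_form poly_fun_matrix)
  then obtain P where P: "poly_fun P" "\<And>x. ?q x = P (\<sigma> x)"
    by (rule invariant_factors) blast
  show ?thesis
  proof (rule that[OF P(1)])
    show "P (\<sigma> v) \<noteq> 0"
      unfolding P(2)[symmetric] using c finite_G by (auto simp: form_diff)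
    fix w assume "P (\<sigma> w) \<noteq> 0"
    then have "?p (mat 1 *v w) \<noteq> 0"
      unfolding P(2)[symmetric] prod_zero_iff[OF finite_G, of "\<lambda>B. ?p (B *v w)"] using one_G by blast
    then show "w \<in> free_locus G"
      using finite_G by (force simp: free_locus_def)
  qed
qed

text \<open>At a free point \<open>v\<close>, cutting \<open>x - v\<close> off to second order at the other points of the orbit
  and summing over the group gives invariants that are tangent to the coordinates at \<open>v\<close>.\<close>

lemma exists_invariant_coordinates:
  assumes "v \<in> free_locus G"
  obtains P :: "'n \<Rightarrow> complex^'m \<Rightarrow> complex"
  where "\<And>i. poly_fun (P i)" "((\<lambda>x. \<chi> i. P i (\<sigma> x)) has_derivative (\<lambda>w. w)) (at v)"
proof -
  let ?S = "(\<lambda>B. v - B *v v) ` (G - {mat 1})"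
  have "0 \<notin> ?S"
    using assms by (auto simp: free_locus_def)
  then obtain c where c: "\<And>B. B \<in> G - {mat 1} \<Longrightarrow> form c (v - B *v v) \<noteq> 0"
    using exists_form_nonzero[of ?S] finite_G by fastforce
  \<comment> \<open>A Lagrange interpolation factor: 1 at \<open>v\<close> and 0 at the other points
    of its orbit.\<close>
  define k where "k x = (\<Prod>B\<in>G - {mat 1}. (form c x - form c (B *v v)) * (1 / form c (v - B *v v)))" for x
  have kpoly: "poly_fun k"
    unfolding k_def[abs_def]
    by (intro poly_fun_prod poly_fun_diff poly_fun_form poly_fun.mult poly_fun.const)
  have kv: "k v = 1"
    unfolding k_def by (rule prod.neutral) (use c in \<open>auto simp: form_diff\<close>)
  have k0: "k (B *v v) = 0" if "B \<in> G - {mat 1}" for B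
    unfolding k_def using that finite_G by (intro prod_zero bexI[of _ B]) auto
  \<comment> \<open>Squaring \<open>k\<close> makes both the value and the first derivative vanish
    at the other orbit points.\<close>
  define p where "p i x = (x $ i - v $ i) * (k x * k x)" for i x
  have ppoly: "poly_fun (p i)" for i
    unfolding p_def[abs_def] by (intro poly_fun.mult poly_fun_diff poly_fun.coord poly_fun.const kpoly)
  have "\<exists>P. poly_fun P \<and> (\<forall>x. (\<Sum>B\<in>G. p i (B *v x)) = P (\<sigma> x))" for i
    using invariant_factors[OF sum_invariant[OF ppoly]] by metis
  then obtain P where P: "\<And>i. poly_fun (P i)" "\<And>i x. (\<Sum>B\<in>G. p i (B *v x)) = P i (\<sigma> x)"
    by metis
  have dp: "((\<lambda>x. p i (B *v x)) has_derivative (\<lambda>w. if B = mat 1 then w $ i else 0)) (at v)"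
    if B: "B \<in> G" for B i
  proof -
    obtain L where L: "((\<lambda>x. k (B *v x)) has_derivative L) (at v)"
      using poly_fun_cdiff_at[OF poly_fun_matrix[OF kpoly]] unfolding cdiff_at_def by blast
    have "poly_fun (\<lambda>x. (B *v x) $ i - v $ i)"
      by (rule poly_fun_matrix[OF poly_fun_diff[OF poly_fun.coord poly_fun.const]])
    then obtain M where M: "((\<lambda>x. (B *v x) $ i - v $ i) has_derivative M) (at v)"
      using poly_fun_cdiff_at unfolding cdiff_at_def by blast
    \<comment> \<open>For nontrivial \<open>B\<close> every term contains
      \<open>k (B *v v) = 0\<close>. For the identity the first term vanishes and \<open>M w\<close>
      remains.\<close>
    have D: "((\<lambda>x. p i (B *v x)) has_derivative
       (\<lambda>w. ((B *v v) $ i - v $ i) * (k (B *v v) * L w + L w * k (B *v v)) + M w * (k (B *v v) * k (B *v v)))) (at v)"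
      unfolding p_def by (intro has_derivative_mult L M)
    show ?thesis
    proof (cases "B = mat 1")
      case True
      have "((\<lambda>x. (B *v x) $ i - v $ i) has_derivative (\<lambda>w. w $ i)) (at v)"
        using has_derivative_diff[OF bounded_linear_imp_has_derivative[OF bounded_linear_vec_nth] has_derivative_const]
          True by simp
      then have "M = (\<lambda>w. w $ i)"
        using M has_derivative_unique by blast
      then show ?thesis using D True kv by simp
    next
      case False
      then show ?thesis using D k0 B by simp
    qed
  qed
  have "((\<lambda>x. \<chi> i. P i (\<sigma> x)) has_derivative (\<lambda>w. w)) (at v)"
  proof (rule has_derivative_vecI)
    fix i
    have "((\<lambda>x. \<Sum>B\<in>G. p i (B *v x)) has_derivative (\<lambda>w. \<Sum>B\<in>G. if B = mat 1 then w $ i else 0)) (at v)"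
      by (intro has_derivative_sum dp)
    then show "((\<lambda>x. (\<chi> i. P i (\<sigma> x)) $ i) has_derivative (\<lambda>w. w $ i)) (at v)"
      using finite_G one_G by (simp add: P(2))
  qed
  then show ?thesis using that P(1) by blast
qed

end

section \<open>Lifting\<close>

text \<open>Since \<open>q\<close> is tangent to the identity, increments of \<open>F\<close> and of
  \<open>q\<close> composed with \<open>F\<close> differ by a small multiple of the increment of
  \<open>F\<close>. Absorbing that multiple bounds the increment of \<open>F\<close> linearly, and
  the difference becomes negligible.\<close>

lemma has_derivative_of_local_coordinates:
  fixes F :: "'a::real_normed_vector \<Rightarrow> 'b::real_normed_vector"
  assumes q: "(q has_derivative (\<lambda>w. w)) (at (F a))" and F: "isCont F a"
    and qF: "((\<lambda>x. q (F x)) has_derivative K) (at a)"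
  shows "(F has_derivative K) (at a)"
  unfolding has_derivative_at_alt
proof (intro conjI allI impI)
  show K: "bounded_linear K"
    using qF by (rule has_derivative_bounded_linear)
  obtain C where C: "C > 0" "\<And>h. norm (K h) \<le> norm h * C"
    using bounded_linear.pos_bounded[OF K] by blast
  fix e :: real assume e: "e > 0"
  \<comment> \<open>The bound 1/2 permits absorption into the left side; the other bound leaves an
    error of at most \<open>e / 2\<close> after the linear estimate for \<open>F\<close>.\<close>
  define e1 where "e1 = min (1/2) (e / (4 * (C + 1)))"
  define e2 where "e2 = min 1 (e / 2)"
  have e12: "e1 > 0" "e2 > 0" "e1 \<le> 1/2" "e2 \<le> 1" "e2 \<le> e / 2" "e1 * (2 * (C + 1)) \<le> e / 2"
  proof -
    show "e1 > 0" "e2 > 0" "e2 \<le> 1" "e2 \<le> e / 2"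
      using e C(1) by (auto simp: e1_def e2_def)
    show "e1 \<le> 1/2"
      unfolding e1_def by (rule min.cobounded1)
    have "e1 * (2 * (C + 1)) \<le> e / (4 * (C + 1)) * (2 * (C + 1))"
      using C(1) by (intro mult_right_mono) (auto simp: e1_def)
    also have "\<dots> = e / 2" using C(1) by (simp add: field_simps)
    finally show "e1 * (2 * (C + 1)) \<le> e / 2" .
  qed
  obtain d1 where d1: "d1 > 0"
    "\<And>z. norm (z - F a) < d1 \<Longrightarrow> norm (q z - q (F a) - (z - F a)) \<le> e1 * norm (z - F a)"
    using q e12(1) unfolding has_derivative_at_alt by blast
  obtain d2 where d2: "d2 > 0" "\<And>y. dist y a < d2 \<Longrightarrow> dist (F y) (F a) < d1"
    using F d1(1) unfolding continuous_at_eps_delta by blast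
  obtain d3 where d3: "d3 > 0"
    "\<And>y. norm (y - a) < d3 \<Longrightarrow> norm (q (F y) - q (F a) - K (y - a)) \<le> e2 * norm (y - a)"
    using qF e12(2) unfolding has_derivative_at_alt by blast
  show "\<exists>d>0. \<forall>y. norm (y - a) < d \<longrightarrow> norm (F y - F a - K (y - a)) \<le> e * norm (y - a)"
  proof (intro exI[of _ "min d2 d3"] conjI allI impI)
    show "min d2 d3 > 0" using d2 d3 by simp
    fix y assume y: "norm (y - a) < min d2 d3"
    define n where "n = norm (F y - F a)"
    define h where "h = norm (y - a)"
    have A: "norm (q (F y) - q (F a) - (F y - F a)) \<le> e1 * n"
      using d1(2) d2(2)[of y] y by (simp add: dist_norm n_def)
    have B: "norm (q (F y) - q (F a) - K (y - a)) \<le> e2 * h"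
      using d3(2) y by (simp add: h_def)
    have h0: "h \<ge> 0" and n0: "n \<ge> 0" by (simp_all add: h_def n_def)
    have "n \<le> norm (q (F y) - q (F a) - (F y - F a)) + norm (q (F y) - q (F a) - K (y - a)) + norm (K (y - a))"
      unfolding n_def by norm
    also have "\<dots> \<le> 1/2 * n + 1 * h + h * C"
      using A B C(2)[of "y - a"] mult_right_mono[OF e12(3) n0] mult_right_mono[OF e12(4) h0]
      unfolding h_def[symmetric] by linarith
    finally have n: "n \<le> 2 * (C + 1) * h" by (simp add: algebra_simps)
    have "norm (F y - F a - K (y - a)) \<le> e1 * n + e2 * h"
    proof -
      have "norm (F y - F a - K (y - a))
          \<le> norm (q (F y) - q (F a) - (F y - F a)) + norm (q (F y) - q (F a) - K (y - a))"
        by norm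
      then show ?thesis using A B by linarith
    qed
    also have "\<dots> \<le> e1 * (2 * (C + 1) * h) + e2 * h"
      using n e12(1) by simp
    also have "\<dots> \<le> e / 2 * h + e / 2 * h"
      using mult_right_mono[OF e12(6) h0] mult_right_mono[OF e12(5) h0] by (simp add: mult.assoc)
    finally show "norm (F y - F a - K (y - a)) \<le> e * norm (y - a)"
      by (simp add: h_def)
  qed
qed

context finite_quotient
begin

text \<open>The invariant coordinates at \<open>F a\<close> composed with the lift are polynomials
  in \<open>f\<close>, hence complex differentiable; the derivative then transfers to
  \<open>F\<close>.\<close>

lemma continuous_lift_cdiff_at:
  fixes f :: "complex^'p \<Rightarrow> complex^'m"
  assumes W: "open W" "a \<in> W" and cont: "continuous_on W F" and free: "F a \<in> free_locus G"
    and lift: "\<And>x. x \<in> W \<Longrightarrow> \<sigma> (F x) = f x"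
    and f: "\<And>i. cdiff_at (\<lambda>x. f x $ i) a"
  shows "cdiff_at (\<lambda>x. F x $ i) a"
proof -
  obtain P :: "'n \<Rightarrow> complex^'m \<Rightarrow> complex" where P: "\<And>i. poly_fun (P i)"
    "((\<lambda>x. \<chi> i. P i (\<sigma> x)) has_derivative (\<lambda>w. w)) (at (F a))"
    using exists_invariant_coordinates[OF free] by blast
  have "cdiff_at (\<lambda>x. P i (f x)) a" for i
    by (rule poly_fun_compose_cdiff_at[OF P(1) f])
  then obtain L where L: "\<And>i. ((\<lambda>x. P i (f x)) has_derivative L i) (at a)"
    "\<And>i c v. L i (c *s v) = c * L i v"
    unfolding cdiff_at_def by metis
  have "((\<lambda>x. \<chi> i. P i (f x)) has_derivative (\<lambda>w. \<chi> i. L i w)) (at a)"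
    by (rule has_derivative_vecI) (simp add: L)
  then have "((\<lambda>x. \<chi> i. P i (\<sigma> (F x))) has_derivative (\<lambda>w. \<chi> i. L i w)) (at a)"
    by (rule has_derivative_transform_within_open[OF _ W]) (simp add: lift)
  moreover have "isCont F a"
    using cont W by (simp add: continuous_on_eq_continuous_at)
  ultimately have "(F has_derivative (\<lambda>w. \<chi> i. L i w)) (at a)"
    using has_derivative_of_local_coordinates[where F=F and a=a, OF P(2)] by blast
  then have "((\<lambda>x. F x $ i) has_derivative (\<lambda>w. (\<chi> i. L i w) $ i)) (at a)"
    by (rule bounded_linear.has_derivative[OF bounded_linear_vec_nth])
  then show ?thesis
    unfolding cdiff_at_def by (intro exI[of _ "L i"]) (simp add: L)
qed

text \<open>The cluster set of the lift at a boundary point lies in a fibre of \<open>\<sigma>\<close>, which is finite,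
  and it is connected.\<close>

lemma lift_has_limit:
  fixes f :: "'a::metric_space \<Rightarrow> complex^'m"
  assumes a: "a \<in> U" "a \<in> closure W" and WU: "W \<subseteq> U"
    and f: "continuous_on U f" and F: "continuous_on W F"
    and lift: "\<And>x. x \<in> W \<Longrightarrow> \<sigma> (F x) = f x"
    and r0: "r0 > 0" and con: "\<And>r. 0 < r \<Longrightarrow> r \<le> r0 \<Longrightarrow> connected (W \<inter> ball a r)"
  shows "\<exists>l. \<forall>e>0. \<exists>r>0. \<forall>x\<in>W \<inter> ball a r. dist (F x) l < e"
proof -
  define S where "S = \<sigma> -` {f a}"
  have cluster: "\<exists>l r. strict_mono r \<and> (\<lambda>n. F (X (r n))) \<longlonglongrightarrow> l \<and> l \<in> S"
    if X: "\<And>n. X n \<in> W" "X \<longlonglongrightarrow> a" for X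
  proof -
    have "(\<lambda>n. f (X n)) \<longlonglongrightarrow> f a"
      by (rule continuous_on_tendsto_compose[OF f X(2) a(1)]) (use X(1) WU in \<open>auto intro!: always_eventually\<close>)
    then have "(\<lambda>n. \<sigma> (F (X n))) \<longlonglongrightarrow> f a"
      using lift X(1) by simp
    then obtain l r where "strict_mono r" "((\<lambda>n. F (X n)) \<circ> r) \<longlonglongrightarrow> l" "\<sigma> l = f a"
      by (rule sigma_convergent_subseq)
    then show ?thesis
      by (intro exI[of _ l] exI[of _ r]) (auto simp: S_def o_def)
  qed
  \<comment> \<open>Otherwise a sequence tending to \<open>a\<close> would keep its values at
    distance at least \<open>e\<close> from the fibre, against the cluster property.\<close>
  have near: "\<exists>r>0. \<forall>x\<in>W \<inter> ball a r. \<exists>s\<in>S. dist (F x) s < e" if "e > 0" for e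
  proof (rule ccontr)
    assume neg: "\<not> ?thesis"
    have "\<exists>x. x \<in> W \<and> dist x a < inverse (real (Suc n)) \<and> (\<forall>s\<in>S. dist (F x) s \<ge> e)" for n
    proof -
      have "inverse (real (Suc n)) > 0" by simp
      then show ?thesis
        using neg by (metis IntE dist_commute mem_ball not_le)
    qed
    then obtain X where X: "\<And>n. X n \<in> W" "\<And>n. dist (X n) a < inverse (real (Suc n))"
      "\<And>n s. s \<in> S \<Longrightarrow> dist (F (X n)) s \<ge> e"
      by metis
    have "X \<longlonglongrightarrow> a"
      by (rule metric_tendsto_imp_tendsto[OF LIMSEQ_inverse_real_of_nat])
         (use X(2) in \<open>auto intro!: always_eventually less_imp_le\<close>)
    then obtain l r where "(\<lambda>n. F (X (r n))) \<longlonglongrightarrow> l" "l \<in> S"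
      using cluster X(1) by blast
    then have "\<forall>\<^sub>F n in sequentially. dist (F (X (r n))) l < e"
      using \<open>e > 0\<close> by (intro tendstoD)
    then show False
      using X(3)[OF \<open>l \<in> S\<close>] by (auto simp: eventually_sequentially not_less[symmetric])
  qed
  have "finite S"
  proof (cases "S = {}")
    case False
    then obtain v where "\<sigma> v = f a" by (auto simp: S_def)
    then have "w \<in> (\<lambda>A. A *v v) ` G" if "w \<in> S" for w
      using that sigma_separates_orbits[of v w] by (auto simp: S_def)
    then show ?thesis
      by (intro finite_surj[OF finite_G]) blast
  qed simp
  obtain X where X: "\<And>n. X n \<in> W" "X \<longlonglongrightarrow> a"
    using a(2) unfolding closure_sequential by blast
  obtain l \<rho> where l: "strict_mono \<rho>" "(\<lambda>n. F (X (\<rho> n))) \<longlonglongrightarrow> l" "l \<in> S"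
    using cluster[OF X] by blast
  have Xlim: "(\<lambda>n. X (\<rho> n)) \<longlonglongrightarrow> a"
    using LIMSEQ_subseq_LIMSEQ[OF X(2) l(1)] by (simp add: o_def)
  obtain d where d: "d > 0" "\<And>s. s \<in> S \<Longrightarrow> s \<noteq> l \<Longrightarrow> d \<le> dist l s"
    using finite_set_avoid[OF \<open>finite S\<close>, of l] by blast
  show ?thesis
  proof (intro exI[of _ l] allI impI)
    fix e :: real assume "e > 0"
    define e' where "e' = min e (d / 2)"
    have e': "e' > 0" "e' \<le> e" "2 * e' \<le> d"
      using \<open>e > 0\<close> d(1) by (auto simp: e'_def)
    obtain r1 where r1: "r1 > 0" "\<And>x. x \<in> W \<inter> ball a r1 \<Longrightarrow> \<exists>s\<in>S. dist (F x) s < e'"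
      using near[OF e'(1)] by blast
    define r where "r = min r0 r1"
    have r: "r > 0" "r \<le> r0" "r \<le> r1"
      using r0 r1 by (auto simp: r_def)
    \<comment> \<open>Balls of radius at most half the gap \<open>d\<close> separate
      \<open>l\<close> from the rest of the fibre. The connected image meets \<open>?A\<close> along
      the chosen sequence, so it lies entirely in it.\<close>
    let ?A = "ball l e'" and ?B = "\<Union>s\<in>S - {l}. ball s e'"
    have conn: "connected (F ` (W \<inter> ball a r))"
      using con[OF r(1,2)] F by (intro connected_continuous_image) (auto intro: continuous_on_subset)
    have opn: "open ?A" "open ?B" by auto
    have disj: "?A \<inter> ?B \<inter> F ` (W \<inter> ball a r) = {}"
    proof -
      have "ball l e' \<inter> ball s e' = {}" if "s \<in> S - {l}" for s
        using d(2)[of s] that e'(3) by (intro disjoint_ballI) auto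
      then show ?thesis by blast
    qed
    have cover: "F ` (W \<inter> ball a r) \<subseteq> ?A \<union> ?B"
    proof clarify
      fix x assume x: "x \<in> W" "x \<in> ball a r" "F x \<notin> ?B"
      then obtain s where "s \<in> S" "dist (F x) s < e'"
        using r1(2)[of x] r(3) by auto
      then show "F x \<in> ?A" using x(3) by (cases "s = l") (auto simp: dist_commute)
    qed
    have "?A \<inter> F ` (W \<inter> ball a r) \<noteq> {}"
    proof -
      have "\<forall>\<^sub>F n in sequentially. dist (F (X (\<rho> n))) l < e' \<and> dist (X (\<rho> n)) a < r"
        using tendstoD[OF l(2) e'(1)] tendstoD[OF Xlim r(1)] by eventually_elim simp
      then obtain n where "dist (F (X (\<rho> n))) l < e'" "dist (X (\<rho> n)) a < r"
        by (auto simp: eventually_sequentially)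
      then show ?thesis using X(1)[of "\<rho> n"] by (auto simp: dist_commute)
    qed
    then have "?B \<inter> F ` (W \<inter> ball a r) = {}"
      using connectedD[OF conn opn disj cover] by argo
    then have "F ` (W \<inter> ball a r) \<subseteq> ?A"
      using cover by blast
    then have "\<forall>x\<in>W \<inter> ball a r. dist (F x) l < e"
      using e'(2) by (fastforce simp: dist_commute)
    then show "\<exists>r>0. \<forall>x\<in>W \<inter> ball a r. dist (F x) l < e"
      using r(1) by blast
  qed
qed

text \<open>The extension is the pointwise limit of \<open>F\<close>. Density of \<open>W\<close>
  gives its continuity, by comparison at a nearby point of \<open>W\<close>, and carries the lifting
  equation over to the limit.\<close>

lemma lift_extends_continuously:
  fixes f :: "'a::metric_space \<Rightarrow> complex^'m"
  assumes U: "open U" and WU: "W \<subseteq> U" and dense: "U \<subseteq> closure W"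
    and f: "continuous_on U f" and F: "continuous_on W F"
    and lift: "\<And>x. x \<in> W \<Longrightarrow> \<sigma> (F x) = f x"
    and con: "\<And>a r. 0 < r \<Longrightarrow> ball a r \<subseteq> U \<Longrightarrow> connected (W \<inter> ball a r)"
  obtains F' where "continuous_on U F'" "\<And>x. x \<in> W \<Longrightarrow> F' x = F x" "\<And>x. x \<in> U \<Longrightarrow> \<sigma> (F' x) = f x"
proof -
  have "\<exists>l. \<forall>e>0. \<exists>r>0. \<forall>x\<in>W \<inter> ball a r. dist (F x) l < e" if a: "a \<in> U" for a
  proof -
    obtain r0 where r0: "r0 > 0" "ball a r0 \<subseteq> U"
      using U a open_contains_ball by blast
    have "connected (W \<inter> ball a r)" if "0 < r" "r \<le> r0" for r
      using con[OF that(1)] r0(2) that(2) by (meson order_trans subset_ball)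
    then show ?thesis
      using lift_has_limit[OF a _ WU f F lift r0(1)] dense a by blast
  qed
  then obtain F' where F': "\<And>a e. a \<in> U \<Longrightarrow> e > 0 \<Longrightarrow> \<exists>r>0. \<forall>x\<in>W \<inter> ball a r. dist (F x) (F' a) < e"
    by metis
  have eq: "F' a = F a" if "a \<in> W" for a
  proof (rule ccontr)
    assume "F' a \<noteq> F a"
    \<comment> \<open>With this distance as tolerance, \<open>a\<close> itself as the test point
      would give a number less than itself.\<close>
    then have "dist (F a) (F' a) > 0" by simp
    from F'[OF subsetD[OF WU that] this]
    obtain r where r: "r > 0" "\<forall>x\<in>W \<inter> ball a r. dist (F x) (F' a) < dist (F a) (F' a)"
      by blast
    have "a \<in> W \<inter> ball a r" using that r(1) by simp
    with r(2) show False by blast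
  qed
  have cont: "continuous_on U F'"
    unfolding continuous_on_iff
  proof (intro ballI allI impI)
    fix a and e :: real assume a: "a \<in> U" and e: "e > 0"
    obtain r where r: "r > 0" "\<And>x. x \<in> W \<inter> ball a r \<Longrightarrow> dist (F x) (F' a) < e / 2"
      using F'[OF a half_gt_zero[OF e]] by blast
    show "\<exists>d>0. \<forall>x'\<in>U. dist x' a < d \<longrightarrow> dist (F' x') (F' a) < e"
    proof (intro exI[of _ r] conjI ballI impI r(1))
      fix b assume b: "b \<in> U" "dist b a < r"
      obtain t where t: "t > 0" "\<And>x. x \<in> W \<inter> ball b t \<Longrightarrow> dist (F x) (F' b) < e / 2"
        using F'[OF b(1) half_gt_zero[OF e]] by blast
      have "b \<in> closure W" "min t (r - dist b a) > 0"
        using dense b t by auto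
      \<comment> \<open>The second bound keeps \<open>x\<close> inside the ball about
        \<open>a\<close>, so both limit estimates apply to it.\<close>
      then obtain x where x: "x \<in> W" "dist x b < min t (r - dist b a)"
        unfolding closure_approachable by blast
      have "dist x a < r"
        using x(2) dist_triangle[of x a b] by simp
      then have "dist (F x) (F' a) < e / 2" "dist (F x) (F' b) < e / 2"
        using r(2)[of x] t(2)[of x] x by (auto simp: dist_commute)
      then show "dist (F' b) (F' a) < e"
        using dist_triangle3[of "F' b" "F' a" "F x"] by simp
    qed
  qed
  have "\<sigma> (F' x) = f x" if x: "x \<in> U" for x
  proof -
    obtain X where X: "\<And>n. X n \<in> W" "X \<longlonglongrightarrow> x"
      using subsetD[OF dense x] unfolding closure_sequential by blast
    have XU: "\<forall>\<^sub>F n in sequentially. X n \<in> U"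
      using X(1) WU by (intro always_eventually) auto
    have "(\<lambda>n. \<sigma> (F' (X n))) \<longlonglongrightarrow> \<sigma> (F' x)"
      by (intro tendsto_sigma continuous_on_tendsto_compose[OF cont X(2) x XU])
    moreover have "(\<lambda>n. \<sigma> (F' (X n))) \<longlonglongrightarrow> f x"
      using continuous_on_tendsto_compose[OF f X(2) x XU] X(1) by (simp add: eq lift)
    ultimately show ?thesis by (rule LIMSEQ_unique)
  qed
  then show ?thesis using that cont eq by blast
qed

section \<open>The two implications of the lifting criterion\<close>

lemma lift_imp_pi1_image_subset:
  fixes f :: "complex^'p \<Rightarrow> complex^'m"
  assumes F: "continuous_on U F" and lift: "\<And>x. x \<in> U \<Longrightarrow> \<sigma> (F x) = f x"
    and x0: "x0 \<in> U" and v0: "\<sigma> v0 = f x0"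
  shows "pi1_image_subset f (U \<inter> f -` (\<sigma> ` free_locus G)) x0 \<sigma> (free_locus G) v0 (\<sigma> ` free_locus G)"
  unfolding pi1_image_subset_def
proof (intro allI impI, elim conjE)
  fix \<gamma> assume \<gamma>: "path \<gamma>" "path_image \<gamma> \<subseteq> U \<inter> f -` (\<sigma> ` free_locus G)"
    "pathstart \<gamma> = x0" "pathfinish \<gamma> = x0"
  \<comment> \<open>\<open>F x0\<close> and \<open>v0\<close> lie in one fibre; translating the lift
    corrects its base point.\<close>
  obtain A where A: "A \<in> G" "v0 = A *v F x0"
    using sigma_separates_orbits[of "F x0" v0] lift[OF x0] v0 by metis
  define \<delta> where "\<delta> = (\<lambda>x. A *v F x) \<circ> \<gamma>"
  have "continuous_on (path_image \<gamma>) (\<lambda>x. A *v F x)"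
    using \<gamma>(2) by (intro continuous_on_compose2[OF continuous_on_matrix[of UNIV] continuous_on_subset[OF F]]) auto
  then have "path \<delta>"
    unfolding \<delta>_def by (rule path_continuous_image[OF \<gamma>(1)])
  moreover have eq: "\<sigma> (A *v F x) = f x" if "x \<in> path_image \<gamma>" for x
    using that \<gamma>(2) A(1) by (auto simp: sigma_invariant lift)
  moreover have "path_image \<delta> \<subseteq> free_locus G"
  proof -
    have "A *v F x \<in> free_locus G" if "x \<in> path_image \<gamma>" for x
      using eq[OF that] that \<gamma>(2) sigma_in_free_iff by (metis IntD2 subsetD vimageE)
    then show ?thesis by (auto simp: \<delta>_def path_image_compose)
  qed
  moreover have "pathstart \<delta> = v0" "pathfinish \<delta> = v0"
    using \<gamma>(3,4) A(2) by (simp_all add: \<delta>_def pathstart_compose pathfinish_compose)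
  moreover have "homotopic_paths (\<sigma> ` free_locus G) (f \<circ> \<gamma>) (\<sigma> \<circ> \<delta>)"
  proof (rule homotopic_paths_eq)
    have eq': "(f \<circ> \<gamma>) t = (\<sigma> \<circ> \<delta>) t" if "t \<in> {0..1}" for t
      using eq[of "\<gamma> t"] that by (simp add: \<delta>_def path_image_def)
    then show "\<And>t. t \<in> {0..1} \<Longrightarrow> (f \<circ> \<gamma>) t = (\<sigma> \<circ> \<delta>) t" .
    \<comment> \<open>Continuity of \<open>f\<close> is not among the hypotheses, so continuity of
      \<open>f \<circ> \<gamma>\<close> is read off from this path, which agrees with it on the unit
      interval.\<close>
    have "path (\<sigma> \<circ> \<delta>)"
      by (rule path_continuous_image[OF \<open>path \<delta>\<close> continuous_on_sigma])
    then show "path (f \<circ> \<gamma>)"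
      unfolding path_def using continuous_on_eq eq' by metis
    show "path_image (f \<circ> \<gamma>) \<subseteq> \<sigma> ` free_locus G"
      using \<gamma>(2) by (auto simp: path_image_compose)
  qed
  ultimately show "\<exists>\<delta>. path \<delta> \<and> path_image \<delta> \<subseteq> free_locus G \<and> pathstart \<delta> = v0 \<and>
      pathfinish \<delta> = v0 \<and> homotopic_paths (\<sigma> ` free_locus G) (f \<circ> \<gamma>) (\<sigma> \<circ> \<delta>)"
    by blast
qed

lemma pi1_image_subset_imp_lift:
  fixes f :: "complex^'p \<Rightarrow> complex^'m"
  assumes U: "open U" "connected U" and f: "holo_on U f" and fim: "f ` U \<subseteq> range \<sigma>"
    and x0: "x0 \<in> U" "f x0 \<in> \<sigma> ` free_locus G" and v0: "\<sigma> v0 = f x0"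
    and pi1: "pi1_image_subset f (U \<inter> f -` (\<sigma> ` free_locus G)) x0 \<sigma> (free_locus G) v0 (\<sigma> ` free_locus G)"
  shows "\<exists>F. holo_on U F \<and> (\<forall>x\<in>U. \<sigma> (F x) = f x)"
proof -
  have v0free: "v0 \<in> free_locus G"
    using x0(2) v0 sigma_in_free_iff by metis
  obtain P where P: "poly_fun P" "P (\<sigma> v0) \<noteq> 0" "\<And>w. P (\<sigma> w) \<noteq> 0 \<Longrightarrow> w \<in> free_locus G"
    using exists_discriminant[OF v0free] by blast
  \<comment> \<open>The work is done on the complement \<open>W\<close> of a single hypersurface,
    where the density and connectedness results apply, rather than on the whole preimage of the free
    part.\<close>
  define h where "h x = P (f x)" for x
  define W where "W = {x \<in> U. h x \<noteq> 0}"
  have fc: "cdiff_at (\<lambda>x. f x $ i) x" if "x \<in> U" for x i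
    using f that by (simp add: holo_on_iff_components)
  have hc: "cdiff_at h x" if "x \<in> U" for x
    unfolding h_def[abs_def] by (rule poly_fun_compose_cdiff_at[OF P(1) fc[OF that]])
  have hx0: "h x0 \<noteq> 0" using P(2) v0 by (simp add: h_def)
  have x0W: "x0 \<in> W" using x0 hx0 by (simp add: W_def)
  have WU: "W \<subseteq> U" by (auto simp: W_def)
  have openW: "open W"
    unfolding W_def by (rule open_nonzero[OF U(1) hc])
  have pcW: "path_connected W"
    unfolding W_def by (rule path_connected_nonzero[OF U hc])
  have dense: "U \<subseteq> closure W"
    unfolding W_def by (rule nonzero_dense[OF U hc x0(1) hx0])
  have contf: "continuous_on U f"
    using f by (rule holo_on_imp_continuous_on)
  have fW: "f x \<in> \<sigma> ` free_locus G" if "x \<in> W" for x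
  proof -
    have "f x \<in> range \<sigma>" using fim that by (auto simp: W_def)
    then obtain v where "f x = \<sigma> v" by (rule rangeE)
    then show ?thesis using P(3)[of v] that by (auto simp: W_def h_def)
  qed
  \<comment> \<open>Lifting criterion for coverings. Loops in \<open>W\<close> are loops in the
    preimage of the free part, so the assumption on fundamental groups covers them.\<close>
  obtain F where F: "continuous_on W F" "F \<in> W \<rightarrow> free_locus G" "F x0 = v0" "\<And>x. x \<in> W \<Longrightarrow> \<sigma> (F x) = f x"
  proof (rule covering_space_lift_general[OF covering_space_sigma v0free x0W pcW])
    show "locally path_connected W"
      using openW by (rule open_imp_locally_path_connected)
    show "continuous_on W f" using contf WU by (rule continuous_on_subset)
    show "f \<in> W \<rightarrow> \<sigma> ` free_locus G" using fW by blast
    show "f x0 = \<sigma> v0" using v0 by simp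
    fix \<gamma> assume "path \<gamma>" "path_image \<gamma> \<subseteq> W" "pathstart \<gamma> = x0" "pathfinish \<gamma> = x0"
    moreover from this have "path_image \<gamma> \<subseteq> U \<inter> f -` (\<sigma> ` free_locus G)"
      using WU fW by blast
    ultimately show "\<exists>q. path q \<and> path_image q \<subseteq> free_locus G \<and> pathstart q = v0 \<and> pathfinish q = v0 \<and>
        homotopic_paths (\<sigma> ` free_locus G) (f \<circ> \<gamma>) (\<sigma> \<circ> q)"
      using pi1 unfolding pi1_image_subset_def by blast
  qed blast
  have conW: "connected (W \<inter> ball a r)" if "ball a r \<subseteq> U" for a r
  proof -
    have "connected {x \<in> ball a r. h x \<noteq> 0}"
      using that hc by (intro connected_nonzero_convex) auto
    moreover have "{x \<in> ball a r. h x \<noteq> 0} = W \<inter> ball a r"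
      using that by (auto simp: W_def)
    ultimately show ?thesis by simp
  qed
  obtain F' where F': "continuous_on U F'" "\<And>x. x \<in> W \<Longrightarrow> F' x = F x" "\<And>x. x \<in> U \<Longrightarrow> \<sigma> (F' x) = f x"
    using lift_extends_continuously[OF U(1) WU dense contf F(1,4) conW] by blast
  have "cdiff_at (\<lambda>x. F' x $ i) a" if a: "a \<in> U" for a i
  \<comment> \<open>On \<open>W\<close> the values are free points, where invariant coordinates give
    differentiability; across the zeros of \<open>h\<close> the continuous extension supplies
    it.\<close>
  proof (rule continuous_extension_cdiff_at[OF U(1) _ hc _ _ a])
    show "continuous_on U (\<lambda>x. F' x $ i)"
      using F'(1) by (intro continuous_intros)
    show "U \<subseteq> closure {x \<in> U. h x \<noteq> 0}"
      using dense by (simp add: W_def)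
    fix x assume "x \<in> U" "h x \<noteq> 0"
    then have x: "x \<in> W" by (simp add: W_def)
    have "F' x \<in> free_locus G"
      using F(2) F'(2)[OF x] x by auto
    then show "cdiff_at (\<lambda>x. F' x $ i) x"
      using WU F'(3) x by (intro continuous_lift_cdiff_at[OF openW x _ _ _ fc[OF \<open>x \<in> U\<close>]] continuous_on_subset[OF F'(1)]) auto
  qed
  then have "holo_on U F'" by (simp add: holo_on_iff_components)
  then show ?thesis using F'(3) by blast
qed

end

theorem theorem4p4:
  fixes G :: "(complex^'n^'n) set"
    and \<sigma> :: "complex^'n \<Rightarrow> complex^'m"
    and U :: "(complex^'p) set"
    and f :: "complex^'p \<Rightarrow> complex^'m"
    and x0 :: "complex^'p" and v0 :: "complex^'n"
  assumes "finite_linear_group G"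
    and "minimal_homogeneous_generators G \<sigma>"
    and "open U" and "connected U"
    and "holo_on U f" and "f ` U \<subseteq> range \<sigma>"
    and "x0 \<in> U \<inter> f -` (\<sigma> ` free_locus G)"
    and "\<sigma> v0 = f x0"
  shows "(\<exists>F. holo_on U F \<and> (\<forall>x\<in>U. \<sigma> (F x) = f x)) \<longleftrightarrow>
         pi1_image_subset f (U \<inter> f -` (\<sigma> ` free_locus G)) x0
                          \<sigma> (free_locus G) v0 (\<sigma> ` free_locus G)"
proof -
  interpret finite_quotient G \<sigma>
    using assms by unfold_locales
  show ?thesis
    using lift_imp_pi1_image_subset[of U _ f x0 v0] pi1_image_subset_imp_lift[of U f x0 v0]
      holo_on_imp_continuous_on assms by blast
qed

end
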